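(* Let $\beta>0$, let $L_1(x)=\log(1+x)>0$ (slowly varying at $\infty$), and suppose $$\mathbf{P}(X_\infty=j)=\frac{C_0}{j\,L_1(j)^{\beta+1}},\qquad j\ge1,$$ where $C_0>0$ is the normalizing constant. Then $\mathbf{E}(X_\infty^q)=\infty$ for all $q>0$. In this case, $\mathbf{P}(X_\infty>j)\sim C_0\cdot L_1(j)^{-\beta}$ as $j\to\infty$, with tails heavier than any power-law. Let $\Phi_\infty(z)=\mathbf{E}(z^{X_\infty})$. Then: (i) The random variable $\nu$ whose distribution function $F(j)=\mathbf{P}(\nu\le j)$ solves $\mathbf{P}(X_\infty\le j)=\Phi_\infty(F(j))$, $j\ge1$ (that is, $F(j)=\Phi_\infty^{-1}(\mathbf{P}(X_\infty\le j))$), is a well-defined random variable obeying $j\,\mathbf{P}(\nu>j)\to e^{-\gamma}$ as $j\to\infty$. (ii) Furthermore, as $j\to\infty$, $$\mathbf{P}(\nu>j)=\frac{e^{-\gamma}}{j}+\frac{d}{j\log j}+o\!\left(\frac{1}{j\log j}\right)$$ with $$d=-\frac{(\beta+1)e^{-\gamma}\pi^2}{12}<-\frac{e^{-\gamma}\pi^2}{12}.$$ The corresponding Lamperti chain (with branching number $\nu$) is critical but it remains positive recurrent for all $\beta>0$.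
   Context: $\gamma$ is the Euler constant; $\pi$ in the formulas for $d$ is the number $3.14159\ldots$; $\sim$ means that the ratio of the two sides tends to $1$. The Lamperti chain (maximal branching process) with branching number $\nu$ is the Markov chain on $\{1,2,\dots\}$ given by $X_{n+1}=\max_{j=1,\dots,X_n}\nu_{j,n+1}$ with $\nu_{j,n+1}$ i.i.d. copies of $\nu$, i.e. with transition matrix $P(i,j)=F(j)^i-F(j-1)^i$, $F(0)=0$. "Critical" refers to the case $\mathbf{P}(\nu>i)\sim e^{-\gamma}/i+d/(i\log i)$, where by Lamperti's criterion the chain is positive recurrent if $d<-e^{-\gamma}\pi^2/12$, null recurrent if $d\in[-e^{-\gamma}\pi^2/12,\,e^{-\gamma}\pi^2/12)$, and transient if $d>e^{-\gamma}\pi^2/12$.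
   Formalization: The tail asymptotic is stated with the constant C_0/β in place of C_0, since summing the given probabilities yields P(X_∞>j) ~ (C_0/β) L_1(j)^{-β}; the printed formula holds only for β=1. *)

theory Defs
  imports "HOL-Probability.Probability" "HOL-Library.Landau_Symbols"
begin

definition L1 :: "real \<Rightarrow> real" where
  "L1 x = ln (1 + x)"

definition slowly_varying :: "(real \<Rightarrow> real) \<Rightarrow> bool" where
  "slowly_varying L \<longleftrightarrow> (\<forall>c>0. ((\<lambda>x. L (c * x) / L x) \<longlongrightarrow> 1) at_top)"

text \<open>Random variables with values in \<open>{1,2,\<dots>}\<close> are represented by their laws, as PMFs on
  the naturals without mass at \<open>0\<close>.\<close>

definition tail :: "nat pmf \<Rightarrow> nat \<Rightarrow> real" where
  "tail p j = measure_pmf.prob p {j<..}"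

definition cdf_nat :: "nat pmf \<Rightarrow> nat \<Rightarrow> real" where
  "cdf_nat p j = measure_pmf.prob p {..j}"

definition pgf :: "nat pmf \<Rightarrow> real \<Rightarrow> real" where
  "pgf p z = measure_pmf.expectation p (\<lambda>x. z ^ x)"

definition branching_law :: "nat pmf \<Rightarrow> nat pmf \<Rightarrow> bool" where
  "branching_law X \<nu> \<longleftrightarrow>
     set_pmf \<nu> \<subseteq> {1..} \<and> (\<forall>j\<ge>1. cdf_nat X j = pgf X (cdf_nat \<nu> j))"

text \<open>The Lamperti chain is realised on the product space carrying an i.i.d. family
  \<open>\<omega> (j, n)\<close> of copies of \<open>\<nu>\<close>. If \<open>\<nu> \<ge> 1\<close> almost surely and the initial state is at least \<open>1\<close>,
  the set whose maximum is taken is almost surely nonempty.\<close>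

definition lamperti_space :: "nat pmf \<Rightarrow> (nat \<times> nat \<Rightarrow> nat) measure" where
  "lamperti_space \<nu> = (\<Pi>\<^sub>M k\<in>UNIV. measure_pmf \<nu>)"

primrec lamperti_chain :: "nat \<Rightarrow> (nat \<times> nat \<Rightarrow> nat) \<Rightarrow> nat \<Rightarrow> nat" where
  "lamperti_chain i \<omega> 0 = i"
| "lamperti_chain i \<omega> (Suc n) = Max ((\<lambda>j. \<omega> (j, Suc n)) ` {1..lamperti_chain i \<omega> n})"

text \<open>The infimum of the empty set is \<open>\<infinity>\<close>, so finite expectation of the return time entails
  almost sure return.\<close>

definition return_time :: "(nat \<Rightarrow> 'a) \<Rightarrow> ennreal" where
  "return_time x = (INF n\<in>{n. 0 < n \<and> x n = x 0}. of_nat n)"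

definition lamperti_positive_recurrent :: "nat pmf \<Rightarrow> bool" where
  "lamperti_positive_recurrent \<nu> \<longleftrightarrow>
     (\<forall>i\<ge>1. (\<integral>\<^sup>+\<omega>. return_time (lamperti_chain i \<omega>) \<partial>lamperti_space \<nu>) < \<infinity>)"

definition lamperti_critical :: "nat pmf \<Rightarrow> real \<Rightarrow> bool" where
  "lamperti_critical \<nu> d \<longleftrightarrow>
     tail \<nu> \<sim>[at_top]
       (\<lambda>i. exp (- euler_mascheroni) / real i + d / (real i * ln (real i)))"

end

theory Submission
  imports Defs "HOL-Real_Asymp.Real_Asymp"
begin

text \<open>With \<open>t = P(\<nu> > j)\<close>, \<open>z = 1 - t\<close> and \<open>\<chi> k = 1 - z^k\<close> for \<open>k \<le> j\<close>, \<open>\<chi> k = - z^k\<close> for \<open>k > j\<close>, the equation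
  defining \<open>\<nu>\<close> reads \<open>\<Sum>k. P(X = k) \<chi> k = 0\<close>. Expanding \<open>(L1 j / L1 k) powr (\<beta> + 1)\<close> to first order around
  \<open>k = j\<close> and replacing \<open>L1\<close> by the harmonic numbers \<open>H\<close> leaves two series with closed forms:
  \<open>\<Sum>k. \<chi> k / k = H j + ln t\<close>, which forces \<open>t\<close> to be about \<open>exp (- \<gamma>) / j\<close>, and
  \<open>\<Sum>k. (H k - H j) \<chi> k / k = (\<Sum>k\<le>j. 1 / k^2) / 2 - dilog (1 - t) - (H j + ln t)^2 / 2\<close>,
  which tends to \<open>- \<pi>^2 / 12\<close> and yields the second-order term.

  The defining equation also says that \<open>X\<close> is stationary for the Lamperti chain. The probability of being at \<open>z\<close>
  at time \<open>n\<close> without having returned to \<open>i\<close>, summed over \<open>n\<close> and multiplied by \<open>P(X = i)\<close>, is therefore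
  at most \<open>P(X = z)\<close>, so the expected return time to \<open>i\<close> is at most \<open>1 / P(X = i)\<close>.\<close>

section \<open>Probability generating functions\<close>

lemma pgf_sums:
  assumes "0 \<le> z" "z \<le> 1"
  shows "(\<lambda>k. pmf p k * z ^ k) sums pgf p z"
proof -
  have "integrable (measure_pmf p) (\<lambda>k. z ^ k)"
    by (rule measure_pmf.integrable_const_bound[where B=1]) (use assms in \<open>auto simp: power_le_one\<close>)
  then have "integrable (count_space UNIV) (\<lambda>k. pmf p k * z ^ k)"
    unfolding measure_pmf_eq_density by (subst (asm) integrable_density) (auto simp: pmf_nonneg)
  then have "(\<lambda>k. pmf p k * z ^ k) sums (\<integral>k. pmf p k * z ^ k \<partial>count_space UNIV)"
    by (rule sums_integral_count_space_nat)
  moreover have "(\<integral>k. pmf p k * z ^ k \<partial>count_space UNIV) = pgf p z"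
    unfolding pgf_def measure_pmf_eq_density by (subst integral_density) (auto simp: pmf_nonneg)
  ultimately show ?thesis by simp
qed

section \<open>Distribution functions and tails\<close>

lemma cdf_nat_eq_sum: "cdf_nat p j = (\<Sum>k\<le>j. pmf p k)"
  unfolding cdf_nat_def by (simp add: measure_measure_pmf_finite)

lemma cdf_nat_Suc: "cdf_nat p (Suc j) = cdf_nat p j + pmf p (Suc j)"
  by (simp add: cdf_nat_eq_sum)

lemma tail_eq: "tail p j = 1 - cdf_nat p j"
proof -
  have "{j<..} = UNIV - {..j}" by auto
  then show ?thesis
    unfolding tail_def cdf_nat_def using measure_pmf.prob_compl[of "{..j}" p] by simp
qed

lemma cdf_nat_nonneg: "0 \<le> cdf_nat p j"
  by (simp add: cdf_nat_def)

lemma cdf_nat_le_1: "cdf_nat p j \<le> 1"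
  by (simp add: cdf_nat_def)

lemma mono_cdf_nat: "mono (cdf_nat p)"
  by (rule monoI) (auto simp: cdf_nat_def intro!: measure_pmf.finite_measure_mono)

lemma sums_pmf: "pmf p sums 1"
  using pgf_sums[of 1 p] by (simp add: pgf_def)

lemma cdf_nat_LIMSEQ: "cdf_nat p \<longlonglongrightarrow> 1"
  using sums_pmf[of p] unfolding sums_def_le cdf_nat_eq_sum .

lemma cdf_nat_0:
  assumes "set_pmf p \<subseteq> {1..}"
  shows "cdf_nat p 0 = 0"
  using assms by (auto simp: cdf_nat_eq_sum set_pmf_eq subset_iff)

lemma pmf_eqI_cdf:
  assumes "\<And>j. cdf_nat p j = cdf_nat q j"
  shows "p = q"
proof (rule pmf_eqI)
  fix i show "pmf p i = pmf q i"
    using assms[of i] assms[of "i - 1"] by (cases i) (auto simp: cdf_nat_eq_sum)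
qed

lemma pmf_of_cdf:
  fixes F :: "nat \<Rightarrow> real"
  assumes "mono F" "F 0 = 0" "F \<longlonglongrightarrow> 1"
  obtains p where "set_pmf p \<subseteq> {1..}" "cdf_nat p = F"
proof -
  \<comment> \<open>At \<open>j = 0\<close> the truncated subtraction makes \<open>f 0 = 0\<close>,
    so no mass is placed at \<open>0\<close>; the partial sums still telescope to \<open>F\<close>
    because \<open>F 0 = 0\<close>.\<close>
  define f where "f j = F j - F (j - 1)" for j
  have f_nonneg: "f j \<ge> 0" for j
    unfolding f_def using monoD[OF assms(1), of "j - 1" j] by simp
  have sumf: "(\<Sum>k\<le>j. f k) = F j" for j
    by (induction j) (auto simp: f_def assms(2))
  have "f sums 1"
    unfolding sums_def_le sumf by (rule assms(3))
  then have "(\<integral>\<^sup>+x. ennreal (f x) \<partial>count_space UNIV) = 1"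
    by (simp add: nn_integral_count_space_nat suminf_ennreal_eq[OF f_nonneg])
  then have pmf: "pmf (embed_pmf f) x = f x" for x
    using f_nonneg by (intro pmf_embed_pmf)
  show ?thesis
  proof
    show "set_pmf (embed_pmf f) \<subseteq> {1..}"
      using f_def[of 0] by (auto simp: set_pmf_eq pmf Suc_le_eq intro: gr0I)
    show "cdf_nat (embed_pmf f) = F"
      by (simp add: fun_eq_iff cdf_nat_eq_sum pmf sumf)
  qed
qed

section \<open>The generating function as a bijection of the unit interval\<close>

lemma pgf_0:
  assumes "set_pmf p \<subseteq> {1..}"
  shows "pgf p 0 = 0"
proof -
  have "pmf p k * 0 ^ k = 0" for k
    using assms by (cases k) (auto simp: set_pmf_eq)
  then have "(\<lambda>k. pmf p k * 0 ^ k) = (\<lambda>k. 0)" by (rule ext)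
  with pgf_sums[of 0 p] have "(\<lambda>k. 0) sums pgf p 0" by simp
  then show ?thesis using sums_unique2[OF sums_zero] by metis
qed

lemma pgf_1: "pgf p 1 = 1"
  by (simp add: pgf_def)

lemma pgf_strict_mono_on:
  assumes "set_pmf p \<subseteq> {1..}"
  shows "strict_mono_on {0..1} (pgf p)"
proof (rule strict_mono_onI)
  fix a b :: real assume ab: "a \<in> {0..1}" "b \<in> {0..1}" "a < b"
  \<comment> \<open>A single atom \<open>i >= 1\<close> suffices: all terms of the difference series
    are nonnegative, and the one at \<open>i\<close> is positive.\<close>
  obtain i where i: "i \<in> set_pmf p" using set_pmf_not_empty[of p] by blast
  then have "i \<ge> 1" "pmf p i > 0" using assms by (auto simp: pmf_positive)
  have sm: "(\<lambda>k. pmf p k * b ^ k - pmf p k * a ^ k) sums (pgf p b - pgf p a)"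
    using ab by (intro sums_diff pgf_sums) auto
  have "0 < (\<Sum>k. pmf p k * b ^ k - pmf p k * a ^ k)"
  proof (rule suminf_pos2)
    show "summable (\<lambda>k. pmf p k * b ^ k - pmf p k * a ^ k)" using sm by (rule sums_summable)
    show "0 \<le> pmf p k * b ^ k - pmf p k * a ^ k" for k
      using ab by (simp add: mult_left_mono power_mono)
    have "a ^ i < b ^ i" using ab \<open>i \<ge> 1\<close> by (intro power_strict_mono) auto
    then show "0 < pmf p i * b ^ i - pmf p i * a ^ i" using \<open>pmf p i > 0\<close> by simp
  qed
  then show "pgf p a < pgf p b" using sm by (simp add: sums_iff)
qed

text \<open>The radius of convergence may be exactly 1, so continuity inside the disc does not reach
  the endpoint. The masses \<open>pmf p k\<close> are a summable majorant on the closed interval and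
  give uniform convergence there.\<close>

lemma continuous_on_pgf: "continuous_on {0..1} (pgf p)"
proof -
  have "uniform_limit {0..1} (\<lambda>n z. \<Sum>k<n. pmf p k * z ^ k) (\<lambda>z. \<Sum>k. pmf p k * z ^ k) sequentially"
    by (rule Weierstrass_m_test[where M="pmf p"])
       (auto simp: power_le_one mult_left_le intro: sums_summable sums_pmf)
  then have "continuous_on {0..1} (\<lambda>z. \<Sum>k. pmf p k * z ^ k)"
    by (rule uniform_limit_theorem[rotated]) (auto intro!: always_eventually continuous_intros)
  moreover have "(\<Sum>k. pmf p k * z ^ k) = pgf p z" if "z \<in> {0..1}" for z
    using pgf_sums[of z p] that by (simp add: sums_iff)
  ultimately show ?thesis using continuous_on_cong by (metis (no_types, lifting))
qed

lemma bij_betw_pgf: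
  assumes "set_pmf p \<subseteq> {1..}"
  shows "bij_betw (pgf p) {0..1} {0..1}"
proof -
  note smo = pgf_strict_mono_on[OF assms]
  have "pgf p z \<in> {0..1}" if "z \<in> {0..1}" for z
    using strict_mono_on_leD[OF smo, of 0 z] strict_mono_on_leD[OF smo, of z 1] that
    by (simp add: pgf_0[OF assms] pgf_1)
  moreover have "\<exists>z\<in>{0..1}. pgf p z = y" if "y \<in> {0..1}" for y
    using IVT'[of "pgf p" 0 y 1] that continuous_on_pgf[of p] by (force simp: pgf_0[OF assms] pgf_1)
  ultimately show ?thesis
    unfolding bij_betw_def using strict_mono_on_imp_inj_on[OF smo] by auto (metis atLeastAtMost_iff imageI)
qed

section \<open>Existence and uniqueness of the branching law\<close>

lemma branching_law_cdf:
  assumes "set_pmf X \<subseteq> {1..}" "branching_law X \<nu>"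
  shows "cdf_nat \<nu> j = the_inv_into {0..1} (pgf X) (cdf_nat X j)"
proof -
  have "cdf_nat X j = pgf X (cdf_nat \<nu> j)"
    \<comment> \<open>\<open>branching_law\<close> states the equation for \<open>j >= 1\<close>
      only. At \<open>j = 0\<close> both sides vanish, since neither law charges
      \<open>0\<close>.\<close>
    using assms by (cases "j = 0") (auto simp: branching_law_def cdf_nat_0 pgf_0)
  then show ?thesis
    using the_inv_into_f_f[OF bij_betw_imp_inj_on[OF bij_betw_pgf[OF assms(1)]]]
    by (simp add: cdf_nat_nonneg cdf_nat_le_1)
qed

text \<open>The inverse of \<open>pgf X\<close> is increasing and fixes \<open>0\<close> and
  \<open>1\<close>, so it turns the distribution function of \<open>X\<close> into another one.
  Uniqueness holds because a law is determined by its distribution function.\<close>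

lemma ex1_branching_law:
  assumes X: "set_pmf X \<subseteq> {1..}"
  shows "\<exists>!\<nu>. branching_law X \<nu>"
proof (rule ex_ex1I)
  note smo = pgf_strict_mono_on[OF X] and bij = bij_betw_pgf[OF X]
  define F where "F j = the_inv_into {0..1} (pgf X) (cdf_nat X j)" for j
  have F: "F j \<in> {0..1}" "pgf X (F j) = cdf_nat X j" for j
    using bij_betw_apply[OF bij_betw_the_inv_into[OF bij], of "cdf_nat X j"]
      f_the_inv_into_f_bij_betw[OF bij, of "cdf_nat X j"]
    by (auto simp: F_def cdf_nat_nonneg cdf_nat_le_1)
  have "F i \<le> F j" if "i \<le> j" for i j
    using strict_mono_on_less_eq[OF smo F(1) F(1), of i j] monoD[OF mono_cdf_nat that] by (simp add: F)
  then have "mono F" by (rule monoI)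
  moreover have "F 0 = 0"
    using strict_mono_on_eqD[OF smo, of 0 "F 0"] F[of 0] by (simp add: cdf_nat_0[OF X] pgf_0[OF X])
  moreover have "F \<longlonglongrightarrow> 1"
  proof (rule order_tendstoI)
    show "eventually (\<lambda>j. F j < a) sequentially" if "a > 1" for a
      by (rule always_eventually) (use F(1) that le_less_trans in fastforce)
    fix a :: real assume "a < 1"
    \<comment> \<open>The truncation at \<open>0\<close> keeps the comparison point inside the
      interval on which \<open>pgf X\<close> is monotone.\<close>
    define b where "b = max a 0"
    have b: "b \<in> {0..1}" "b < 1" using \<open>a < 1\<close> by (auto simp: b_def)
    then have "pgf X b < 1" using strict_mono_onD[OF smo, of b 1] by (simp add: pgf_1)
    then have "eventually (\<lambda>j. pgf X b < cdf_nat X j) sequentially"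
      by (rule order_tendstoD[OF cdf_nat_LIMSEQ])
    then show "eventually (\<lambda>j. a < F j) sequentially"
    proof eventually_elim
      case (elim j)
      then have "b < F j" using strict_mono_on_less[OF smo b(1) F(1), of j] by (simp add: F)
      then show ?case by (simp add: b_def)
    qed
  qed
  ultimately obtain \<nu> where "set_pmf \<nu> \<subseteq> {1..}" "cdf_nat \<nu> = F"
    by (rule pmf_of_cdf)
  then show "\<exists>\<nu>. branching_law X \<nu>" unfolding branching_law_def using F by auto
  show "\<nu> = \<nu>'" if "branching_law X \<nu>" "branching_law X \<nu>'" for \<nu> \<nu>'
    using that by (intro pmf_eqI_cdf) (simp add: branching_law_cdf[OF X])
qed

section \<open>Positive recurrence\<close>

lemma product_prob_space_lamperti: "product_prob_space (\<lambda>_. measure_pmf \<nu>)"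
  by unfold_locales

lemma prob_space_lamperti: "prob_space (lamperti_space \<nu>)"
  unfolding lamperti_space_def by (intro prob_space_PiM measure_pmf.prob_space_axioms)

lemma space_lamperti [simp]: "space (lamperti_space \<nu>) = UNIV"
  by (auto simp: lamperti_space_def space_PiM)

lemma measurable_lamperti_component:
  "(\<lambda>\<omega>. \<omega> k) \<in> lamperti_space \<nu> \<rightarrow>\<^sub>M count_space UNIV"
proof -
  have "(\<lambda>\<omega>. \<omega> k) \<in> lamperti_space \<nu> \<rightarrow>\<^sub>M measure_pmf \<nu>"
    unfolding lamperti_space_def by (rule measurable_component_singleton) simp
  then show ?thesis by (simp cong: measurable_cong_sets)
qed

lemma measurable_Max_atLeastAtMost:
  fixes f :: "nat \<Rightarrow> 'a \<Rightarrow> nat"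
  assumes "\<And>j. f j \<in> N \<rightarrow>\<^sub>M count_space UNIV"
  shows "(\<lambda>\<omega>. Max ((\<lambda>j. f j \<omega>) ` {1..y})) \<in> N \<rightarrow>\<^sub>M count_space UNIV"
proof (induction y)
  case 0
  then show ?case by simp
next
  case (Suc y)
  have "(\<lambda>\<omega>. max a (Max ((\<lambda>j. f j \<omega>) ` {1..y}))) \<in> N \<rightarrow>\<^sub>M count_space UNIV" for a
    using measurable_compose[OF Suc, of "max a"] by simp
  then have "(\<lambda>\<omega>. max (f (Suc y) \<omega>) (Max ((\<lambda>j. f j \<omega>) ` {1..y}))) \<in> N \<rightarrow>\<^sub>M count_space UNIV"
    by (rule measurable_compose_countable[OF _ assms])
  \<comment> \<open>The recursion starts at one element: for \<open>y = 0\<close> the old set is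
    empty and its \<open>Max\<close> carries no information.\<close>
  moreover have "Max ((\<lambda>j. f j \<omega>) ` {1..Suc y}) =
      (if y = 0 then f 1 \<omega> else max (f (Suc y) \<omega>) (Max ((\<lambda>j. f j \<omega>) ` {1..y})))" for \<omega>
    by (simp add: atLeastAtMostSuc_conv)
  ultimately show ?case using assms[of 1] by (cases "y = 0") simp_all
qed

text \<open>The maximum over a random index set is glued from countably many maxima over fixed sets.
  The measure \<open>N\<close> is arbitrary so that the result applies both to the full product
  space and to the product over the generations up to \<open>n\<close>.\<close>

lemma measurable_lamperti_chain:
  assumes "\<And>j k. k \<le> n \<Longrightarrow> (\<lambda>\<omega>. \<omega> (j, k)) \<in> N \<rightarrow>\<^sub>M count_space UNIV"
  shows "(\<lambda>\<omega>. lamperti_chain i \<omega> n) \<in> N \<rightarrow>\<^sub>M count_space UNIV"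
  using assms
proof (induction n)
  case 0
  then show ?case by simp
next
  case (Suc n)
  have "(\<lambda>\<omega>. Max ((\<lambda>j. \<omega> (j, Suc n)) ` {1..y})) \<in> N \<rightarrow>\<^sub>M count_space UNIV" for y
    using Suc.prems by (intro measurable_Max_atLeastAtMost) simp
  then have "(\<lambda>\<omega>. Max ((\<lambda>j. \<omega> (j, Suc n)) ` {1..lamperti_chain i \<omega> n})) \<in> N \<rightarrow>\<^sub>M count_space UNIV"
    by (rule measurable_compose_countable) (use Suc in simp)
  then show ?case by simp
qed

section \<open>Taboo probabilities and one-step transitions\<close>

lemma lamperti_chain_restrict:
  "n \<le> m \<Longrightarrow> lamperti_chain i (restrict \<omega> (UNIV \<times> {..m})) n = lamperti_chain i \<omega> n"
  by (induction n) auto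

text \<open>Time \<open>0\<close> is left out because the chain starts at \<open>i\<close>.\<close>

definition avoids :: "nat \<Rightarrow> nat \<Rightarrow> (nat \<times> nat \<Rightarrow> nat) \<Rightarrow> bool" where
  "avoids i n \<omega> \<longleftrightarrow> (\<forall>m\<in>{1..n}. lamperti_chain i \<omega> m \<noteq> i)"

text \<open>The taboo probabilities of Markov chain theory, with taboo state \<open>i\<close>. At
  \<open>n = 0\<close> they are the point mass at \<open>i\<close>.\<close>

definition taboo :: "nat pmf \<Rightarrow> nat \<Rightarrow> nat \<Rightarrow> nat \<Rightarrow> ennreal" where
  "taboo \<nu> i n z = emeasure (lamperti_space \<nu>) {\<omega>. avoids i n \<omega> \<and> lamperti_chain i \<omega> n = z}"

text \<open>The transition matrix of the chain for \<open>y >= 1\<close>. The case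
  \<open>z = 0\<close> is separate because \<open>z - 1\<close> would again be \<open>0\<close> on
  the naturals.\<close>

definition lamperti_kernel :: "nat pmf \<Rightarrow> nat \<Rightarrow> nat \<Rightarrow> real" where
  "lamperti_kernel \<nu> y z = cdf_nat \<nu> z ^ y - (if z = 0 then 0 else cdf_nat \<nu> (z - 1) ^ y)"

lemma lamperti_kernel_nonneg: "lamperti_kernel \<nu> y z \<ge> 0"
  using monoD[OF mono_cdf_nat, of "z - 1" z \<nu>]
  by (auto simp: lamperti_kernel_def cdf_nat_nonneg intro!: power_mono)

lemma pred_avoids:
  assumes "\<And>j k. k \<le> n \<Longrightarrow> (\<lambda>\<omega>. \<omega> (j, k)) \<in> N \<rightarrow>\<^sub>M count_space UNIV"
  shows "Measurable.pred N (avoids i n)"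
proof -
  have [measurable]: "(\<lambda>\<omega>. lamperti_chain i \<omega> m) \<in> N \<rightarrow>\<^sub>M count_space UNIV" if "m \<in> {1..n}" for m
    using that assms by (intro measurable_lamperti_chain) auto
  have "Measurable.pred N (\<lambda>\<omega>. \<forall>m\<in>{1..n}. lamperti_chain i \<omega> m \<noteq> i)"
    by measurable
  then show ?thesis by (simp add: avoids_def[abs_def])
qed

text \<open>The coordinates are independent under the product measure, and the generations up to
  \<open>n\<close> and generation \<open>Suc n\<close> are disjoint blocks of them. The last two
  assumptions say that \<open>P\<close> and \<open>Q\<close> each read only their own block.\<close>

lemma emeasure_past_future_indep:
  assumes "Measurable.pred (PiM (UNIV \<times> {..n}) (\<lambda>_. measure_pmf \<nu>)) P"
    and "Measurable.pred (PiM (UNIV \<times> {Suc n}) (\<lambda>_. measure_pmf \<nu>)) Q"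
    and "\<And>\<omega>. P (restrict \<omega> (UNIV \<times> {..n})) = P \<omega>" "\<And>\<omega>. Q (restrict \<omega> (UNIV \<times> {Suc n})) = Q \<omega>"
  shows "emeasure (lamperti_space \<nu>) {\<omega>. P \<omega> \<and> Q \<omega>} =
    emeasure (lamperti_space \<nu>) {\<omega>. P \<omega>} * emeasure (lamperti_space \<nu>) {\<omega>. Q \<omega>}"
proof -
  interpret M: prob_space "lamperti_space \<nu>" by (rule prob_space_lamperti)
  let ?A = "(UNIV::nat set) \<times> {..n}" and ?B = "(UNIV::nat set) \<times> {Suc n}"
  have comp: "(\<lambda>\<omega>. \<omega> k) \<in> lamperti_space \<nu> \<rightarrow>\<^sub>M measure_pmf \<nu>" for k
    unfolding lamperti_space_def by (rule measurable_component_singleton) simp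
  have "distr (lamperti_space \<nu>) (measure_pmf \<nu>) (\<lambda>\<omega>. \<omega> k) = measure_pmf \<nu>" for k
    unfolding lamperti_space_def
    by (intro distr_PiM_component measure_pmf.prob_space_axioms) auto
  moreover have "distr (lamperti_space \<nu>) (\<Pi>\<^sub>M i\<in>UNIV. measure_pmf \<nu>) (\<lambda>x. \<lambda>i\<in>UNIV. x i) = lamperti_space \<nu>"
    unfolding lamperti_space_def restrict_UNIV by (rule distr_id)
  ultimately have "M.indep_vars (\<lambda>_. measure_pmf \<nu>) (\<lambda>k \<omega>. \<omega> k) UNIV"
    using comp by (subst M.indep_vars_iff_distr_eq_PiM) (auto simp: lamperti_space_def)
  then have "M.indep_var (PiM ?A (\<lambda>_. measure_pmf \<nu>)) (\<lambda>\<omega>. restrict (\<lambda>i. \<omega> i) ?A)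
      (PiM ?B (\<lambda>_. measure_pmf \<nu>)) (\<lambda>\<omega>. restrict (\<lambda>i. \<omega> i) ?B)"
    by (rule M.indep_var_restrict) auto
  then have "M.indep_var (count_space UNIV) (P \<circ> (\<lambda>\<omega>. restrict (\<lambda>i. \<omega> i) ?A))
      (count_space UNIV) (Q \<circ> (\<lambda>\<omega>. restrict (\<lambda>i. \<omega> i) ?B))"
    using assms(1,2) by (rule M.indep_var_compose)
  then have "M.indep_var (count_space UNIV) P (count_space UNIV) Q"
    by (simp add: comp_def assms(3,4))
  from M.indep_varD[OF this, of "{True}" "{True}"]
  have "M.prob ((\<lambda>x. (P x, Q x)) -` ({True} \<times> {True})) = M.prob (P -` {True}) * M.prob (Q -` {True})"
    by simp
  moreover have "(\<lambda>x. (P x, Q x)) -` ({True} \<times> {True}) = {\<omega>. P \<omega> \<and> Q \<omega>}"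
      "P -` {True} = {\<omega>. P \<omega>}" "Q -` {True} = {\<omega>. Q \<omega>}"
    by auto
  ultimately show ?thesis by (simp add: M.emeasure_eq_measure ennreal_mult)
qed

text \<open>A maximum of a nonempty finite set is at most \<open>z\<close> exactly when every one of
  the \<open>y\<close> independent entries is.\<close>

lemma emeasure_Max_le:
  assumes "y \<ge> 1"
  shows "emeasure (lamperti_space \<nu>) {\<omega>. Max ((\<lambda>j. \<omega> (j, n)) ` {1..y}) \<le> z} = ennreal (cdf_nat \<nu> z ^ y)"
proof -
  interpret P: product_prob_space "\<lambda>_. measure_pmf \<nu>" UNIV by (rule product_prob_space_lamperti)
  have "{\<omega>. Max ((\<lambda>j. \<omega> (j, n)) ` {1..y}) \<le> z} =
      {\<omega> \<in> space (lamperti_space \<nu>). \<forall>k\<in>{1..y} \<times> {n}. \<omega> k \<in> {..z}}"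
    using assms by (auto simp: Max_le_iff)
  then have "emeasure (lamperti_space \<nu>) {\<omega>. Max ((\<lambda>j. \<omega> (j, n)) ` {1..y}) \<le> z} =
     (\<Prod>k\<in>{1..y} \<times> {n}. emeasure (measure_pmf \<nu>) {..z})"
    using P.emeasure_PiM_Collect[of "{1..y} \<times> {n}" "\<lambda>_. {..z}"] by (simp add: lamperti_space_def)
  also have "\<dots> = ennreal (cdf_nat \<nu> z ^ y)"
    by (simp add: cdf_nat_def measure_pmf.emeasure_eq_measure ennreal_power)
  finally show ?thesis .
qed

lemma emeasure_Max_eq:
  assumes "y \<ge> 1"
  shows "emeasure (lamperti_space \<nu>) {\<omega>. Max ((\<lambda>j. \<omega> (j, n)) ` {1..y}) = z} = ennreal (lamperti_kernel \<nu> y z)"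
proof (cases z)
  case 0
  then show ?thesis using emeasure_Max_le[OF assms, of \<nu> n 0] by (simp add: lamperti_kernel_def)
next
  case (Suc w)
  let ?M = "lamperti_space \<nu>" and ?f = "\<lambda>\<omega>. Max ((\<lambda>j. \<omega> (j, n)) ` {1..y})"
  interpret M: prob_space ?M by (rule prob_space_lamperti)
  have f: "?f \<in> ?M \<rightarrow>\<^sub>M count_space UNIV"
    by (intro measurable_Max_atLeastAtMost measurable_lamperti_component)
  have sets: "{\<omega>. ?f \<omega> \<le> w} \<in> sets ?M" for w
    using measurable_sets[OF f, of "{..w}"] by (simp add: vimage_def)
  have "{\<omega>. ?f \<omega> = z} = {\<omega>. ?f \<omega> \<le> Suc w} - {\<omega>. ?f \<omega> \<le> w}"
    using Suc by auto
  moreover have "emeasure ?M ({\<omega>. ?f \<omega> \<le> Suc w} - {\<omega>. ?f \<omega> \<le> w}) =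
      emeasure ?M {\<omega>. ?f \<omega> \<le> Suc w} - emeasure ?M {\<omega>. ?f \<omega> \<le> w}"
    by (rule emeasure_Diff) (use sets in auto)
  ultimately show ?thesis
    using Suc unfolding emeasure_Max_le[OF assms] by (simp add: lamperti_kernel_def ennreal_minus cdf_nat_nonneg)
qed

text \<open>Chapman-Kolmogorov with the state \<open>i\<close> forbidden, as an upper bound. From
  \<open>y = 0\<close> the next state is the \<open>Max\<close> of an empty set, not governed by the
  kernel, so its probability is bounded by \<open>1\<close>.\<close>

lemma taboo_Suc_le:
  "taboo \<nu> i (Suc n) z \<le>
    (if z = i then 0 else \<Sum>y. taboo \<nu> i n y * (if y = 0 then 1 else ennreal (lamperti_kernel \<nu> y z)))"
proof -
  let ?M = "lamperti_space \<nu>"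
  interpret M: prob_space ?M by (rule prob_space_lamperti)
  \<comment> \<open>On \<open>E y\<close> the random number of offspring is replaced by the constant
    \<open>y\<close>, which separates the past from generation \<open>Suc n\<close>.\<close>
  define E where "E y = {\<omega>. (avoids i n \<omega> \<and> lamperti_chain i \<omega> n = y) \<and> Max ((\<lambda>j. \<omega> (j, Suc n)) ` {1..y}) = z}" for y
  have chain: "(\<lambda>\<omega>. lamperti_chain i \<omega> n) \<in> ?M \<rightarrow>\<^sub>M count_space UNIV"
    by (intro measurable_lamperti_chain measurable_lamperti_component)
  have Mx: "(\<lambda>\<omega>. Max ((\<lambda>j. \<omega> (j, Suc n)) ` {1..y})) \<in> ?M \<rightarrow>\<^sub>M count_space UNIV" for y
    by (intro measurable_Max_atLeastAtMost measurable_lamperti_component)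
  have av: "Measurable.pred ?M (avoids i n)"
    by (intro pred_avoids measurable_lamperti_component)
  have "{\<omega>\<in>space ?M. (avoids i n \<omega> \<and> lamperti_chain i \<omega> n = y) \<and> Max ((\<lambda>j. \<omega> (j, Suc n)) ` {1..y}) = z} \<in> sets ?M" for y
    using chain Mx[of y] av by measurable
  then have E_sets: "E y \<in> sets ?M" for y
    by (simp add: E_def)
  have E: "emeasure ?M (E y) \<le> taboo \<nu> i n y * (if y = 0 then 1 else ennreal (lamperti_kernel \<nu> y z))" for y
  proof (cases "y = 0")
    case True
    have "{\<omega>\<in>space ?M. avoids i n \<omega> \<and> lamperti_chain i \<omega> n = 0} \<in> sets ?M"
      using chain av by measurable
    then show ?thesis
      using True by (auto simp: taboo_def E_def intro!: emeasure_mono)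
  next
    case False
    let ?A = "PiM (UNIV \<times> {..n}) (\<lambda>_. measure_pmf \<nu>)" and ?B = "PiM (UNIV \<times> {Suc n}) (\<lambda>_. measure_pmf \<nu>)"
    have cA: "(\<lambda>\<omega>. \<omega> (j, k)) \<in> ?A \<rightarrow>\<^sub>M count_space UNIV" if "k \<le> n" for j k :: nat
    proof -
      have "(\<lambda>\<omega>. \<omega> (j, k)) \<in> ?A \<rightarrow>\<^sub>M measure_pmf \<nu>"
        by (rule measurable_component_singleton) (use that in auto)
      then show ?thesis by (simp cong: measurable_cong_sets)
    qed
    have cB: "(\<lambda>\<omega>. \<omega> (j, Suc n)) \<in> ?B \<rightarrow>\<^sub>M count_space UNIV" for j :: nat
    proof -
      have "(\<lambda>\<omega>. \<omega> (j, Suc n)) \<in> ?B \<rightarrow>\<^sub>M measure_pmf \<nu>"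
        by (rule measurable_component_singleton) auto
      then show ?thesis by (simp cong: measurable_cong_sets)
    qed
    have "(\<lambda>\<omega>. lamperti_chain i \<omega> n) \<in> ?A \<rightarrow>\<^sub>M count_space UNIV"
      by (intro measurable_lamperti_chain cA)
    moreover have "Measurable.pred ?A (avoids i n)"
      by (intro pred_avoids cA)
    ultimately have P: "Measurable.pred ?A (\<lambda>\<omega>. avoids i n \<omega> \<and> lamperti_chain i \<omega> n = y)"
      by measurable
    have "(\<lambda>\<omega>. Max ((\<lambda>j. \<omega> (j, Suc n)) ` {1..y})) \<in> ?B \<rightarrow>\<^sub>M count_space UNIV"
      by (intro measurable_Max_atLeastAtMost cB)
    then have Q: "Measurable.pred ?B (\<lambda>\<omega>. Max ((\<lambda>j. \<omega> (j, Suc n)) ` {1..y}) = z)"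
      by measurable
    have "emeasure ?M (E y) = taboo \<nu> i n y *
        emeasure ?M {\<omega>. Max ((\<lambda>j. \<omega> (j, Suc n)) ` {1..y}) = z}"
      unfolding E_def taboo_def
      by (rule emeasure_past_future_indep[OF P Q]) (auto simp: avoids_def lamperti_chain_restrict)
    then show ?thesis using False emeasure_Max_eq[of y \<nu> "Suc n" z] by simp
  qed
  have sub: "{\<omega>. avoids i (Suc n) \<omega> \<and> lamperti_chain i \<omega> (Suc n) = z} \<subseteq> (if z = i then {} else (\<Union>y. E y))"
    by (auto simp: avoids_def E_def atLeastAtMostSuc_conv)
  show ?thesis
  proof (cases "z = i")
    case True
    then have "{\<omega>. avoids i (Suc n) \<omega> \<and> lamperti_chain i \<omega> (Suc n) = z} = {}"
      using sub True by (simp only: simp_thms if_True subset_empty)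
    then show ?thesis by (simp only: taboo_def emeasure_empty zero_le)
  next
    case False
    have "taboo \<nu> i (Suc n) z \<le> emeasure ?M (\<Union>y. E y)"
      unfolding taboo_def using sub False E_sets by (intro emeasure_mono) auto
    also have "\<dots> \<le> (\<Sum>y. emeasure ?M (E y))"
      by (intro emeasure_subadditive_countably) (use E_sets in auto)
    also have "\<dots> \<le> (\<Sum>y. taboo \<nu> i n y * (if y = 0 then 1 else ennreal (lamperti_kernel \<nu> y z)))"
      by (intro suminf_le E) auto
    finally show ?thesis using False by simp
  qed
qed

text \<open>The equation for the branching law says that one step from \<open>X\<close> reproduces
  the distribution function of \<open>X\<close>; differencing at \<open>z\<close> and
  \<open>z - 1\<close> gives point masses. The factor \<open>1\<close> at \<open>y = 0\<close> is
  harmless because \<open>pmf X 0 = 0\<close>.\<close>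

lemma kernel_stationary:
  assumes X: "set_pmf X \<subseteq> {1..}" and \<nu>: "branching_law X \<nu>"
  shows "(\<Sum>y. ennreal (pmf X y) * (if y = 0 then 1 else ennreal (lamperti_kernel \<nu> y z))) = ennreal (pmf X z)"
proof -
  have X0: "pmf X 0 = 0" using X by (auto simp: set_pmf_eq)
  have s: "(\<lambda>y. pmf X y * cdf_nat \<nu> w ^ y) sums cdf_nat X w" for w
  proof -
    have "pgf X (cdf_nat \<nu> w) = cdf_nat X w"
      using X \<nu> by (cases "w = 0") (auto simp: branching_law_def cdf_nat_0 pgf_0)
    then show ?thesis using pgf_sums[of "cdf_nat \<nu> w" X] by (simp add: cdf_nat_nonneg cdf_nat_le_1)
  qed
  have "(\<lambda>y. pmf X y * lamperti_kernel \<nu> y z) sums pmf X z"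
  proof (cases z)
    case 0
    then show ?thesis using s[of 0] by (simp add: lamperti_kernel_def cdf_nat_eq_sum)
  next
    case (Suc w)
    then show ?thesis
      using sums_diff[OF s[of "Suc w"] s[of w]] by (simp add: lamperti_kernel_def algebra_simps cdf_nat_Suc)
  qed
  then have "(\<Sum>y. ennreal (pmf X y * lamperti_kernel \<nu> y z)) = ennreal (pmf X z)"
    by (intro suminf_ennreal_eq) (auto simp: lamperti_kernel_nonneg)
  moreover have "ennreal (pmf X y) * (if y = 0 then 1 else ennreal (lamperti_kernel \<nu> y z)) =
      ennreal (pmf X y * lamperti_kernel \<nu> y z)" for y
    using X0 by (simp add: ennreal_mult lamperti_kernel_nonneg)
  ultimately show ?thesis by simp
qed

text \<open>Induction on the time horizon. At \<open>z = i\<close> only time \<open>0\<close>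
  contributes. At any other \<open>z\<close> time \<open>0\<close> contributes nothing, and the
  later times are carried back one step through the kernel, where the induction hypothesis and
  stationarity apply.\<close>

lemma taboo_sum_le:
  assumes X: "set_pmf X \<subseteq> {1..}" and \<nu>: "branching_law X \<nu>"
  shows "ennreal (pmf X i) * (\<Sum>n\<le>N. taboo \<nu> i n z) \<le> ennreal (pmf X z)"
proof (induction N arbitrary: z)
  interpret M: prob_space "lamperti_space \<nu>" by (rule prob_space_lamperti)
  have taboo0: "taboo \<nu> i 0 z = (if z = i then 1 else 0)" for z
    using M.emeasure_space_1 by (auto simp: taboo_def avoids_def)
  {
    case 0
    show ?case by (simp add: taboo0)
  next
    case (Suc N)
    let ?K = "\<lambda>y. if y = 0 then 1 else ennreal (lamperti_kernel \<nu> y z)"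
    show ?case
    proof (cases "z = i")
      case True
      then have "taboo \<nu> i (Suc n) z = 0" for n
        using taboo_Suc_le[of \<nu> i n z] by simp
      then show ?thesis using True by (simp add: sum.atMost_Suc_shift taboo0 del: sum.atMost_Suc)
    next
      case False
      have "ennreal (pmf X i) * (\<Sum>n\<le>Suc N. taboo \<nu> i n z) = ennreal (pmf X i) * (\<Sum>n\<le>N. taboo \<nu> i (Suc n) z)"
        using False by (simp add: sum.atMost_Suc_shift taboo0 del: sum.atMost_Suc)
      also have "\<dots> \<le> ennreal (pmf X i) * (\<Sum>n\<le>N. \<Sum>y. taboo \<nu> i n y * ?K y)"
        using taboo_Suc_le[of \<nu> i _ z] False by (intro mult_left_mono sum_mono) auto
      also have "\<dots> = (\<Sum>y. (ennreal (pmf X i) * (\<Sum>n\<le>N. taboo \<nu> i n y)) * ?K y)"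
        by (simp add: suminf_sum[symmetric] sum_distrib_right ennreal_suminf_cmult[symmetric] mult.assoc
              del: ennreal_suminf_cmult)
      also have "\<dots> \<le> (\<Sum>y. ennreal (pmf X y) * ?K y)"
        by (intro suminf_le mult_right_mono Suc.IH) auto
      also have "\<dots> = ennreal (pmf X z)"
        by (rule kernel_stationary[OF X \<nu>])
      finally show ?thesis .
    qed
  }
qed

text \<open>The indicators count the times \<open>n\<close> up to which no return has occurred. If
  the first return is at \<open>N\<close>, these include \<open>0, ..., N - 1\<close>; without a
  return the sum is infinite.\<close>

lemma return_time_le_suminf:
  "return_time x \<le> (\<Sum>n. indicator {n. \<forall>m\<in>{1..n}. x m \<noteq> x 0} n)"
proof (cases "\<exists>n. 0 < n \<and> x n = x 0")
  case True
  define N where "N = (LEAST n. 0 < n \<and> x n = x 0)"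
  have N: "0 < N" "x N = x 0" using LeastI_ex[OF True] by (auto simp: N_def)
  have "x m \<noteq> x 0" if "0 < m" "m < N" for m
    using not_less_Least[of m "\<lambda>n. 0 < n \<and> x n = x 0"] that by (auto simp: N_def)
  then have "(\<Sum>n<N. indicator {n. \<forall>m\<in>{1..n}. x m \<noteq> x 0} n :: ennreal) = (\<Sum>n<N. 1)"
    by (intro sum.cong) auto
  then have "of_nat N = (\<Sum>n<N. indicator {n. \<forall>m\<in>{1..n}. x m \<noteq> x 0} n :: ennreal)"
    by simp
  also have "\<dots> \<le> (\<Sum>n. indicator {n. \<forall>m\<in>{1..n}. x m \<noteq> x 0} n)"
    by (rule sum_le_suminf) auto
  finally show ?thesis
    using N unfolding return_time_def by (intro INF_lower2[of N]) auto
next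
  case False
  then have "x m \<noteq> x 0" if "0 < m" for m
    using that by blast
  then have "{n. \<forall>m\<in>{1..n}. x m \<noteq> x 0} = UNIV"
    by (intro equalityI subset_UNIV subsetI CollectI ballI) simp
  moreover have "(\<Sum>n::nat. 1 :: ennreal) = \<infinity>"
    using nn_integral_count_space_nat[of "\<lambda>_. 1"] by simp
  ultimately show ?thesis by simp
qed

text \<open>One half of Kac's formula: with \<open>X\<close> stationary, the taboo probabilities summed over time,
  weighted by \<open>pmf X i\<close>, stay below \<open>X\<close>, and their total mass is the expected return time.\<close>

lemma expected_return_time_le:
  assumes X: "set_pmf X \<subseteq> {1..}" and \<nu>: "branching_law X \<nu>"
  shows "ennreal (pmf X i) * (\<integral>\<^sup>+\<omega>. return_time (lamperti_chain i \<omega>) \<partial>lamperti_space \<nu>) \<le> 1"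
proof -
  let ?M = "lamperti_space \<nu>"
  have av: "{\<omega>. avoids i n \<omega>} \<in> sets ?M" for n
    using pred_avoids[of n ?M i] measurable_lamperti_component by (simp add: pred_def)
  have chain: "(\<lambda>\<omega>. lamperti_chain i \<omega> n) \<in> ?M \<rightarrow>\<^sub>M count_space UNIV" for n
    by (intro measurable_lamperti_chain measurable_lamperti_component)
  have em: "emeasure ?M {\<omega>. avoids i n \<omega>} = (\<Sum>z. taboo \<nu> i n z)" for n
  proof -
    have "{\<omega>. avoids i n \<omega> \<and> lamperti_chain i \<omega> n = z} \<in> sets ?M" for z
    proof -
      have "{\<omega>. avoids i n \<omega>} \<inter> ((\<lambda>\<omega>. lamperti_chain i \<omega> n) -` {z} \<inter> space ?M) \<in> sets ?M"
        by (intro sets.Int av measurable_sets[OF chain]) auto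
      moreover have "{\<omega>. avoids i n \<omega>} \<inter> ((\<lambda>\<omega>. lamperti_chain i \<omega> n) -` {z} \<inter> space ?M) =
        {\<omega>. avoids i n \<omega> \<and> lamperti_chain i \<omega> n = z}" by auto
      ultimately show ?thesis by simp
    qed
    then have "(\<Sum>z. taboo \<nu> i n z) = emeasure ?M (\<Union>z. {\<omega>. avoids i n \<omega> \<and> lamperti_chain i \<omega> n = z})"
      unfolding taboo_def by (intro suminf_emeasure) (auto simp: disjoint_family_on_def)
    moreover have "(\<Union>z. {\<omega>. avoids i n \<omega> \<and> lamperti_chain i \<omega> n = z}) = {\<omega>. avoids i n \<omega>}" by auto
    ultimately show ?thesis by simp
  qed
  have "(\<integral>\<^sup>+\<omega>. return_time (lamperti_chain i \<omega>) \<partial>?M) \<le> (\<integral>\<^sup>+\<omega>. (\<Sum>n. indicator {\<omega>. avoids i n \<omega>} \<omega>) \<partial>?M)"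
  proof (rule nn_integral_mono)
    fix \<omega>
    show "return_time (lamperti_chain i \<omega>) \<le> (\<Sum>n. indicator {\<omega>. avoids i n \<omega>} \<omega>)"
      using return_time_le_suminf[of "lamperti_chain i \<omega>"] by (simp add: avoids_def indicator_def)
  qed
  also have "\<dots> = (\<Sum>n. \<Sum>z. taboo \<nu> i n z)"
    by (subst nn_integral_suminf) (simp_all add: borel_measurable_indicator av em)
  finally have "ennreal (pmf X i) * (\<integral>\<^sup>+\<omega>. return_time (lamperti_chain i \<omega>) \<partial>?M) \<le>
      (\<Sum>n. ennreal (pmf X i) * (\<Sum>z. taboo \<nu> i n z))"
    by (simp add: mult_left_mono)
  also have "\<dots> \<le> 1"
  proof (rule suminf_le_const)
    show "summable (\<lambda>n. ennreal (pmf X i) * (\<Sum>z. taboo \<nu> i n z))" by (rule summableI)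
    fix N
    have "(\<Sum>n<N. ennreal (pmf X i) * (\<Sum>z. taboo \<nu> i n z)) \<le> (\<Sum>n\<le>N. ennreal (pmf X i) * (\<Sum>z. taboo \<nu> i n z))"
      by (intro sum_mono2) auto
    also have "\<dots> = (\<Sum>z. ennreal (pmf X i) * (\<Sum>n\<le>N. taboo \<nu> i n z))"
      by (simp add: suminf_sum[symmetric] sum_distrib_left ennreal_suminf_cmult[symmetric] del: ennreal_suminf_cmult)
    also have "\<dots> \<le> (\<Sum>z. ennreal (pmf X z))"
      by (intro suminf_le taboo_sum_le[OF X \<nu>]) auto
    also have "\<dots> = 1"
      using suminf_ennreal_eq[OF pmf_nonneg sums_pmf, of X] by simp
    finally show "(\<Sum>n<N. ennreal (pmf X i) * (\<Sum>z. taboo \<nu> i n z)) \<le> 1" .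
  qed
  finally show ?thesis .
qed

lemma lamperti_positive_recurrentI:
  assumes X: "set_pmf X = {1..}" and \<nu>: "branching_law X \<nu>"
  shows "lamperti_positive_recurrent \<nu>"
  unfolding lamperti_positive_recurrent_def
proof (intro allI impI)
  fix i :: nat assume "1 \<le> i"
  then have "pmf X i > 0" using X by (intro pmf_positive) auto
  moreover have "ennreal (pmf X i) * (\<integral>\<^sup>+\<omega>. return_time (lamperti_chain i \<omega>) \<partial>lamperti_space \<nu>) < \<infinity>"
    using expected_return_time_le[OF _ \<nu>, of i] X by (auto intro: le_less_trans)
  ultimately show "(\<integral>\<^sup>+\<omega>. return_time (lamperti_chain i \<omega>) \<partial>lamperti_space \<nu>) < \<infinity>"
    by (auto simp: ennreal_mult_less_top)
qed

section \<open>Harmonic numbers and the dilogarithm\<close>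

lemma slowly_varying_L1: "slowly_varying L1"
  unfolding slowly_varying_def L1_def
proof (intro allI impI)
  fix c :: real assume "c > 0"
  then show "((\<lambda>x. ln (1 + c * x) / ln (1 + x)) \<longlongrightarrow> 1) at_top" by real_asymp
qed

lemma L1_pos: "x > 0 \<Longrightarrow> L1 x > 0"
  by (simp add: L1_def)

text \<open>Since \<open>ln k = L1 (k - 1)\<close>, the denominator is a decrement of
  \<open>L1 powr (- b)\<close>. It is asymptotic to \<open>b\<close> times the numerator, the input
  for the Stolz-Cesaro estimate of the tail of \<open>X\<close>.\<close>

lemma ln_powr_increment_ratio:
  fixes b :: real assumes "b > 0"
  shows "(\<lambda>k. (1 / (real k * ln (1 + real k) powr (b + 1))) /
    (ln (real k) powr (- b) - ln (1 + real k) powr (- b))) \<longlonglongrightarrow> 1 / b"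
  using assms by real_asymp (simp add: inverse_eq_divide)

text \<open>Isolates what the second-order factor of the trial tail contributes after taking
  logarithms and scaling by \<open>L1 j\<close>.\<close>

lemma ln_times_ln_one_plus_LIMSEQ:
  fixes \<eta> :: real
  shows "(\<lambda>j. ln (1 + real j) * ln (1 + \<eta> / ln (real j))) \<longlonglongrightarrow> \<eta>"
proof (cases "\<eta> = 0")
  case False
  then consider "\<eta> > 0" | "\<eta> < 0" by linarith
  then show ?thesis by cases real_asymp+
qed simp

text \<open>With \<open>x = 1 / (n + 1)\<close> each increment of \<open>harm - L1\<close> is
  \<open>x - ln (1 + x)\<close>. It lies between \<open>0\<close> and \<open>x^2\<close>, and
  \<open>x^2 <= 1 / n - 1 / (n + 1)\<close> telescopes.\<close>

lemma harm_minus_ln_bounds: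
  assumes "1 \<le> k" "k \<le> j"
  shows "0 \<le> (harm j - L1 (real j)) - (harm k - L1 (real k))"
    and "(harm j - L1 (real j)) - (harm k - L1 (real k)) \<le> 1 / real k - 1 / real j"
proof -
  have *: "0 \<le> (harm j - L1 (real j)) - (harm k - L1 (real k)) \<and>
    (harm j - L1 (real j)) - (harm k - L1 (real k)) \<le> 1 / real k - 1 / real j"
    using assms(2)
  proof (induction rule: dec_induct)
    case (step n)
    define x where "x = 1 / real (Suc n)"
    have n: "n \<ge> 1" using step assms by simp
    have x: "0 \<le> x" "x \<le> 1" by (auto simp: x_def)
    have "L1 (real (Suc n)) - L1 (real n) = ln (1 + x)"
    proof -
      have "1 + x = (1 + real (Suc n)) / (1 + real n)" by (simp add: x_def field_simps)
      then show ?thesis by (simp add: L1_def ln_div)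
    qed
    moreover have "ln (1 + x) \<le> x" using x by (intro ln_add_one_self_le_self)
    moreover have "x - x\<^sup>2 \<le> ln (1 + x)" using x by (rule ln_one_plus_pos_lower_bound)
    moreover have "x\<^sup>2 \<le> 1 / real n - 1 / real (Suc n)"
    proof -
      have "x * x \<le> 1 / real n * x"
        using n x by (intro mult_right_mono) (auto simp: x_def frac_le)
      also have "\<dots> = 1 / real n - 1 / real (Suc n)"
        using n by (simp add: x_def field_simps)
      finally show ?thesis by (simp add: power2_eq_square)
    qed
    moreover have "harm (Suc n) = harm n + x"
      by (simp add: harm_Suc x_def field_simps)
    ultimately show ?case using step.IH by linarith
  qed simp
  then show "0 \<le> (harm j - L1 (real j)) - (harm k - L1 (real k))"
    and "(harm j - L1 (real j)) - (harm k - L1 (real k)) \<le> 1 / real k - 1 / real j"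
    by auto
qed

text \<open>Letting the larger index tend to infinity in the preceding bounds puts
  \<open>harm j - L1 j\<close> within \<open>1 / j\<close> of the Euler constant. Replacing
  \<open>L1\<close> by \<open>ln\<close> costs another \<open>1 / j\<close>, and
  \<open>L1 j / j\<close> tends to \<open>0\<close>.\<close>

lemma L1_harm_minus_ln: "(\<lambda>j. L1 (real j) * (harm j - ln (real j) - euler_mascheroni)) \<longlonglongrightarrow> 0"
proof (rule Lim_null_comparison)
  have lim: "(\<lambda>j. harm j - L1 (real j)) \<longlonglongrightarrow> euler_mascheroni"
  proof -
    have "(\<lambda>j. ln (1 + real j) - ln (real j)) \<longlonglongrightarrow> 0" by real_asymp
    from tendsto_diff[OF euler_mascheroni_LIMSEQ this] show ?thesis by (simp add: L1_def)
  qed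
  show "\<forall>\<^sub>F j in sequentially. norm (L1 (real j) * (harm j - ln (real j) - euler_mascheroni)) \<le> L1 (real j) * (2 / real j)"
    using eventually_ge_at_top[of 1]
  proof eventually_elim
    case (elim j)
    have "0 \<le> euler_mascheroni - (harm j - L1 (real j))"
      by (rule tendsto_lowerbound[OF tendsto_diff[OF lim tendsto_const]])
         (use harm_minus_ln_bounds(1) elim in \<open>auto simp: eventually_at_top_linorder intro!: exI[of _ j]\<close>)
    moreover have "euler_mascheroni - (harm j - L1 (real j)) \<le> 1 / real j"
    proof (rule tendsto_upperbound[OF tendsto_diff[OF lim tendsto_const]])
      have "harm i - L1 (real i) - (harm j - L1 (real j)) \<le> 1 / real j" if "i \<ge> j" for i
        using harm_minus_ln_bounds(2)[of j i] elim that by (smt (verit) divide_nonneg_nonneg of_nat_0_le_iff)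
      then show "\<forall>\<^sub>F i in sequentially. harm i - L1 (real i) - (harm j - L1 (real j)) \<le> 1 / real j"
        by (auto simp: eventually_at_top_linorder)
    qed simp
    moreover have "0 \<le> L1 (real j) - ln (real j)" "L1 (real j) - ln (real j) \<le> 1 / real j"
      using elim ln_diff_le[of "1 + real j" "real j"] by (auto simp: L1_def)
    ultimately have "\<bar>harm j - ln (real j) - euler_mascheroni\<bar> \<le> 2 / real j"
      by simp
    then show ?case
      unfolding real_norm_def abs_mult using L1_pos[of "real j"] elim by (intro mult_mono) auto
  qed
  show "(\<lambda>j. L1 (real j) * (2 / real j)) \<longlonglongrightarrow> 0"
    unfolding L1_def by real_asymp
qed

text \<open>Since \<open>x / real 0 = 0\<close>, the series in \<open>1 / k\<close> may start at \<open>k = 0\<close>.\<close>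

definition dilog :: "real \<Rightarrow> real" where
  "dilog z = (\<Sum>k. z ^ k / (real k)\<^sup>2)"

lemma inverse_squares_sums': "(\<lambda>k. 1 / (real k)\<^sup>2) sums (pi\<^sup>2 / 6)"
  using inverse_squares_sums by (subst sums_Suc_iff[symmetric, where f = "\<lambda>k. 1 / (real k)\<^sup>2", simplified]) (simp add: add_ac)

lemma dilog_sums:
  assumes "0 \<le> z" "z \<le> 1"
  shows "(\<lambda>k. z ^ k / (real k)\<^sup>2) sums dilog z"
  unfolding dilog_def
proof (rule summable_sums, rule summable_comparison_test'[where N=0])
  show "summable (\<lambda>k. 1 / (real k)\<^sup>2)" using inverse_squares_sums' by (rule sums_summable)
  show "norm (z ^ k / (real k)\<^sup>2) \<le> 1 / (real k)\<^sup>2" for k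
    using assms by (simp add: power_le_one divide_right_mono)
qed

lemma dilog_1: "dilog 1 = pi\<^sup>2 / 6"
  using inverse_squares_sums' by (simp add: dilog_def sums_iff)

text \<open>Continuity is wanted at the endpoint \<open>1\<close>, on the boundary of the disc of
  convergence, where \<open>dilog (1 - t)\<close> is evaluated as \<open>t\<close> tends to
  \<open>0\<close>.\<close>

lemma continuous_on_dilog: "continuous_on {0..1} dilog"
proof -
  have "uniform_limit {0..1} (\<lambda>n z. \<Sum>k<n. z ^ k / (real k)\<^sup>2) (\<lambda>z. \<Sum>k. z ^ k / (real k)\<^sup>2) sequentially"
    by (rule Weierstrass_m_test[where M="\<lambda>k. 1 / (real k)\<^sup>2"])
       (auto simp: power_le_one intro!: divide_right_mono sums_summable[OF inverse_squares_sums'])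
  then have "continuous_on {0..1} (\<lambda>z. \<Sum>k. z ^ k / (real k)\<^sup>2)"
    by (rule uniform_limit_theorem[rotated])
       (auto intro!: always_eventually continuous_on_sum continuous_on_mult_right continuous_intros simp: divide_inverse)
  then show ?thesis by (simp add: dilog_def[abs_def])
qed

lemma harm_eq_sum_atMost: "harm n = (\<Sum>k\<le>n. 1 / real k)"
  by (induction n) (auto simp: harm_Suc harm_def inverse_eq_divide)

lemma minus_ln_sums:
  fixes z :: real assumes "0 \<le> z" "z < 1"
  shows "(\<lambda>k. z ^ k / real k) sums (- ln (1 - z))"
  using sums_minus[OF ln_series'[of "- z"]] assms by simp

text \<open>The Cauchy square of the series of \<open>ln (1 - z)\<close>.\<close>

lemma harm_power_sums:
  fixes z :: real assumes z: "0 \<le> z" "z < 1"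
  shows "(\<lambda>k. harm k * z ^ k / real k) sums (dilog z + (ln (1 - z))\<^sup>2 / 2)"
proof -
  let ?a = "\<lambda>k. z ^ k / real k"
  have conv: "(\<Sum>i\<le>k. ?a i * ?a (k - i)) = 2 * (harm k * z ^ k / real k) - 2 * (z ^ k / (real k)\<^sup>2)" for k
  proof (cases "k = 0")
    case False
    \<comment> \<open>Partial fractions for \<open>1 / (i * (k - i))\<close>. At
      \<open>i = 0\<close> and \<open>i = k\<close> the left side is \<open>0\<close> by division by
      zero, whereas the fractions leave \<open>1 / k^2\<close>; the two conditional terms remove
      it.\<close>
    have "?a i * ?a (k - i) = z ^ k * (1 / real k * (1 / real i + 1 / real (k - i)) -
        (if i = 0 then 1 / (real k)\<^sup>2 else 0) - (if i = k then 1 / (real k)\<^sup>2 else 0))" if "i \<le> k" for i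
    proof -
      consider "i = 0" | "i = k" | "0 < i" "i < k" using \<open>i \<le> k\<close> by linarith
      then show ?thesis
      proof cases
        case 3
        have "z ^ i * z ^ (k - i) = z ^ k" using that by (simp flip: power_add)
        then have "?a i * ?a (k - i) = z ^ k * (1 / (real i * real (k - i)))" by (simp add: field_simps)
        also have "1 / (real i * real (k - i)) = 1 / real k * (1 / real i + 1 / real (k - i))"
          using 3 by (simp add: of_nat_diff field_simps)
        finally show ?thesis using 3 by simp
      qed (use False in \<open>simp_all add: power2_eq_square\<close>)
    qed
    then have "(\<Sum>i\<le>k. ?a i * ?a (k - i)) = (\<Sum>i\<le>k. z ^ k * (1 / real k * (1 / real i + 1 / real (k - i)) -
        (if i = 0 then 1 / (real k)\<^sup>2 else 0) - (if i = k then 1 / (real k)\<^sup>2 else 0)))"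
      by (intro sum.cong) auto
    also have "\<dots> = z ^ k * (1 / real k * ((\<Sum>i\<le>k. 1 / real i) + (\<Sum>i\<le>k. 1 / real (k - i))) - 2 / (real k)\<^sup>2)"
      by (simp only: sum_distrib_left[symmetric] sum_subtractf sum.distrib) simp
    also have "(\<Sum>i\<le>k. 1 / real (k - i)) = (\<Sum>i\<le>k. 1 / real i)"
      by (rule sum.reindex_bij_witness[of _ "\<lambda>i. k - i" "\<lambda>i. k - i"]) auto
    finally show ?thesis by (simp add: harm_eq_sum_atMost[symmetric] algebra_simps)
  qed simp
  note ln = minus_ln_sums[OF z]
  have "summable (\<lambda>k. norm (?a k))" using ln z by (simp add: sums_iff)
  from Cauchy_product_sums[OF this this]
  have "(\<lambda>k. 2 * (harm k * z ^ k / real k) - 2 * (z ^ k / (real k)\<^sup>2)) sums ((- ln (1 - z)) * (- ln (1 - z)))"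
    unfolding conv using ln by (simp add: sums_iff)
  from sums_mult[OF sums_add[OF this sums_mult[OF dilog_sums[of z], of 2]], of "1/2"] z
  show ?thesis by (simp add: power2_eq_square algebra_simps)
qed

text \<open>Summed against \<open>pmf X\<close> this gives \<open>cdf_nat X j - pgf X z\<close>,
  whose sign tells on which side of \<open>cdf_nat \<nu> j\<close> the point \<open>z\<close>
  lies.\<close>

definition cutoff :: "nat \<Rightarrow> real \<Rightarrow> nat \<Rightarrow> real" where
  "cutoff j z k = (if k \<le> j then 1 else 0) - z ^ k"

section \<open>Closed forms of the cutoff series\<close>

lemma cutoff_sums:
  assumes "(\<lambda>k. f k * z ^ k) sums s"
  shows "(\<lambda>k. f k * cutoff j z k) sums ((\<Sum>k\<le>j. f k) - s)"
proof -
  have "(\<lambda>k. if k \<in> {..j} then f k else 0) sums (\<Sum>k\<in>{..j}. f k)"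
    by (rule sums_If_finite_set) simp
  from sums_diff[OF this assms] show ?thesis
    by (rule back_subst[of "\<lambda>g. g sums _"]) (auto simp: cutoff_def algebra_simps)
qed

text \<open>The sum over pairs \<open>i <= k\<close> is half the full square plus half the
  diagonal.\<close>

lemma sum_harm_div: "(\<Sum>k\<le>n. harm k / real k) = ((harm n)\<^sup>2 + (\<Sum>k\<le>n. 1 / (real k)\<^sup>2)) / 2"
proof (induction n)
  case (Suc n)
  define x where "x = 1 / real (Suc n)"
  have "harm (Suc n) = harm n + x" by (simp add: harm_Suc x_def inverse_eq_divide)
  moreover have "1 / (real (Suc n))\<^sup>2 = x\<^sup>2" by (simp add: x_def power_divide)
  moreover have "harm (Suc n) / real (Suc n) = harm (Suc n) * x" by (simp add: x_def)
  ultimately show ?case using Suc by (simp add: algebra_simps power2_eq_square add_divide_distrib del: of_nat_Suc)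
qed (simp add: harm_def)

lemma cutoff_ln_sums:
  assumes "0 < t" "t < 1"
  shows "(\<lambda>k. 1 / real k * cutoff j (1 - t) k) sums (harm j + ln t)"
  using cutoff_sums[of "\<lambda>k. 1 / real k" "1 - t", of _ j] minus_ln_sums[of "1 - t"] assms
  by (fastforce simp: harm_eq_sum_atMost)

lemma cutoff_harm_sums:
  assumes t: "0 < t" "t < 1"
  shows "(\<lambda>k. (harm k - harm j) / real k * cutoff j (1 - t) k) sums
    ((\<Sum>k\<le>j. 1 / (real k)\<^sup>2) / 2 - dilog (1 - t) - (harm j + ln t)\<^sup>2 / 2)"
proof -
  have "(\<lambda>k. harm k / real k * (1 - t) ^ k) sums (dilog (1 - t) + (ln t)\<^sup>2 / 2)"
    using harm_power_sums[of "1 - t"] t by simp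
  from cutoff_sums[OF this, of j]
  have "(\<lambda>k. harm k / real k * cutoff j (1 - t) k) sums
      (((harm j)\<^sup>2 + (\<Sum>k\<le>j. 1 / (real k)\<^sup>2)) / 2 - (dilog (1 - t) + (ln t)\<^sup>2 / 2))"
    by (simp add: sum_harm_div)
  from sums_diff[OF this sums_mult[OF cutoff_ln_sums[OF t, of j], of "harm j"]]
  have "(\<lambda>k. harm k / real k * cutoff j (1 - t) k - harm j * (1 / real k * cutoff j (1 - t) k)) sums
      (((harm j)\<^sup>2 + (\<Sum>k\<le>j. 1 / (real k)\<^sup>2)) / 2 - (dilog (1 - t) + (ln t)\<^sup>2 / 2) -
        harm j * (harm j + ln t))" .
  moreover have "(\<lambda>k. harm k / real k * cutoff j (1 - t) k - harm j * (1 / real k * cutoff j (1 - t) k)) =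
      (\<lambda>k. (harm k - harm j) / real k * cutoff j (1 - t) k)"
    by (simp add: fun_eq_iff algebra_simps diff_divide_distrib)
  \<comment> \<open>The terms quadratic in \<open>harm j\<close> and \<open>ln t\<close> complete to
    a single square of \<open>harm j + ln t\<close>, so the growth of \<open>harm j\<close> and
    \<open>ln t\<close> cancels when their sum stays bounded.\<close>
  moreover have "((harm j)\<^sup>2 + (\<Sum>k\<le>j. 1 / (real k)\<^sup>2)) / 2 - (dilog (1 - t) + (ln t)\<^sup>2 / 2) -
        harm j * (harm j + ln t) =
      (\<Sum>k\<le>j. 1 / (real k)\<^sup>2) / 2 - dilog (1 - t) - (harm j + ln t)\<^sup>2 / 2"
    by (simp add: power2_eq_square algebra_simps add_divide_distrib)
  ultimately show ?thesis by simp
qed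

text \<open>A majorant in \<open>k / j\<close> that dominates powers of \<open>ln (k / j)\<close> while still being summable
  against \<open>cutoff j z k / k\<close>.\<close>

definition weight :: "nat \<Rightarrow> nat \<Rightarrow> real" where
  "weight j k = (if k \<le> j then sqrt (real j / real k) else real k / real j)"

text \<open>Telescoping of \<open>1 / sqrt n <= 2 * (sqrt n - sqrt (n - 1))\<close>.\<close>

lemma sum_inverse_sqrt_le: "(\<Sum>k\<le>n. 1 / sqrt (real k)) \<le> 2 * sqrt (real n)"
proof (induction n)
  case (Suc n)
  define a where "a = sqrt (real n)"
  define c where "c = sqrt (real (Suc n))"
  have ac: "0 \<le> a" "0 < c" "a \<le> c" "c\<^sup>2 = a\<^sup>2 + 1" by (auto simp: a_def c_def)
  then have "1 = (c - a) * (c + a)" by (simp add: power2_eq_square algebra_simps)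
  also have "\<dots> \<le> (c - a) * (2 * c)" using ac by (intro mult_left_mono) auto
  finally have "1 / c \<le> 2 * (c - a)" using ac by (simp add: field_simps)
  then show ?case using Suc by (simp add: a_def c_def)
qed simp

text \<open>For \<open>k <= j\<close> Bernoulli's inequality bounds the cutoff by
  \<open>k * t\<close>; this cancels \<open>1 / k\<close> and leaves a sum of inverse square roots.
  For \<open>k > j\<close> the weight cancels \<open>1 / k\<close> and leaves a geometric series.
  The bound is of order \<open>\<epsilon>\<close> as long as \<open>t * j\<close> stays away from
  \<open>0\<close> and infinity.\<close>

lemma cutoff_error_bound:
  assumes t: "0 < t" "t < 1" and j: "j \<ge> 1" and "\<epsilon> \<ge> 0"
    and E: "\<And>k. k \<ge> 1 \<Longrightarrow> \<bar>E k\<bar> \<le> \<epsilon> * weight j k"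
  shows "summable (\<lambda>k. E k / real k * cutoff j (1 - t) k)"
    and "\<bar>\<Sum>k. E k / real k * cutoff j (1 - t) k\<bar> \<le> \<epsilon> * (2 * (t * real j) + 1 / (t * real j))"
proof -
  \<comment> \<open>The geometric term is kept also for \<open>k <= j\<close>, where it only
    enlarges the majorant, so that its full series has a closed form.\<close>
  define B where "B k = \<epsilon> * ((if k \<in> {..j} then t * sqrt (real j) * (1 / sqrt (real k)) else 0) + (1 - t) ^ k / real j)" for k
  have "(\<lambda>k. if k \<in> {..j} then t * sqrt (real j) * (1 / sqrt (real k)) else 0) sums
      (\<Sum>k\<in>{..j}. t * sqrt (real j) * (1 / sqrt (real k)))"
    by (rule sums_If_finite_set) simp
  moreover have "(\<lambda>k. (1 - t) ^ k / real j) sums (1 / (t * real j))"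
    using sums_divide[OF geometric_sums[of "1 - t"], of "real j"] t by simp
  ultimately have B: "B sums (\<epsilon> * ((\<Sum>k\<in>{..j}. t * sqrt (real j) * (1 / sqrt (real k))) + 1 / (t * real j)))"
    unfolding B_def by (intro sums_mult sums_add)
  have le: "norm (E k / real k * cutoff j (1 - t) k) \<le> B k" for k
  proof -
    consider "k = 0" | "1 \<le> k" "k \<le> j" | "j < k" by linarith
    then show ?thesis
    proof cases
      case 1
      then show ?thesis using t \<open>\<epsilon> \<ge> 0\<close> by (simp add: B_def)
    next
      case 2
      have "1 - real k * t \<le> (1 - t) ^ k"
        using Bernoulli_inequality[of "- t" k] t by simp
      moreover have "(1 - t) ^ k \<le> 1" using t by (intro power_le_one) auto
      ultimately have c: "\<bar>cutoff j (1 - t) k\<bar> \<le> real k * t" using 2 by (simp add: cutoff_def)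
      have "norm (E k / real k * cutoff j (1 - t) k) = \<bar>E k\<bar> * (\<bar>cutoff j (1 - t) k\<bar> / real k)"
        by (simp add: abs_mult)
      also have "\<dots> \<le> (\<epsilon> * weight j k) * t"
        using 2 E[of k] c by (intro mult_mono) (auto simp: field_simps)
      also have "\<dots> = \<epsilon> * (t * sqrt (real j) * (1 / sqrt (real k)))"
        using 2 by (simp add: weight_def real_sqrt_divide)
      also have "\<dots> \<le> B k"
        unfolding B_def using 2 t \<open>\<epsilon> \<ge> 0\<close> by (intro mult_left_mono) auto
      finally show ?thesis .
    next
      case 3
      have "norm (E k / real k * cutoff j (1 - t) k) = \<bar>E k\<bar> * ((1 - t) ^ k / real k)"
        using 3 t by (simp add: abs_mult cutoff_def)
      also have "\<dots> \<le> (\<epsilon> * weight j k) * ((1 - t) ^ k / real k)"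
        using 3 j E[of k] t by (intro mult_right_mono) auto
      also have "\<dots> = B k"
        using 3 by (simp add: weight_def B_def)
      finally show ?thesis .
    qed
  qed
  have sm: "summable (\<lambda>k. norm (E k / real k * cutoff j (1 - t) k))"
    by (rule summable_comparison_test'[OF sums_summable[OF B], of 0]) (use le in auto)
  then show "summable (\<lambda>k. E k / real k * cutoff j (1 - t) k)" by (rule summable_norm_cancel)
  have "\<bar>\<Sum>k. E k / real k * cutoff j (1 - t) k\<bar> \<le> (\<Sum>k. norm (E k / real k * cutoff j (1 - t) k))"
    using summable_norm[OF sm] by simp
  also have "\<dots> \<le> (\<Sum>k. B k)" by (intro suminf_le le sm sums_summable[OF B])
  also have "\<dots> = \<epsilon> * (t * sqrt (real j) * (\<Sum>k\<le>j. 1 / sqrt (real k)) + 1 / (t * real j))"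
    using B by (simp add: sums_iff sum_distrib_left)
  also have "\<dots> \<le> \<epsilon> * (t * sqrt (real j) * (2 * sqrt (real j)) + 1 / (t * real j))"
    using sum_inverse_sqrt_le[of j] t \<open>\<epsilon> \<ge> 0\<close> by (intro mult_left_mono add_right_mono) auto
  also have "t * sqrt (real j) * (2 * sqrt (real j)) = 2 * (t * real j)" by simp
  finally show "\<bar>\<Sum>k. E k / real k * cutoff j (1 - t) k\<bar> \<le> \<epsilon> * (2 * (t * real j) + 1 / (t * real j))" .
qed

text \<open>The mean value inequality twice: \<open>f\<close> and its derivative \<open>g\<close>
  vanish at \<open>1\<close>, and the second derivative is decreasing, hence largest at the smaller
  of \<open>1\<close> and \<open>x\<close>.\<close>

lemma powr_taylor_bound:
  fixes x b :: real
  assumes "x > 0" "b > 0"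
  shows "\<bar>x powr (- b) - 1 + b * (x - 1)\<bar> \<le> b * (b + 1) * (x - 1)\<^sup>2 * max 1 (x powr (- (b + 2)))"
proof -
  define f where "f y = y powr (- b) - 1 + b * (y - 1)" for y
  define g where "g y = b - b * y powr (- (b + 1))" for y
  define m where "m = max 1 (x powr (- (b + 2)))"
  have f': "(f has_real_derivative g y) (at y)" if "y > 0" for y
  proof -
    have "(f has_real_derivative - b * y powr (- b - 1) + b) (at y)"
      unfolding f_def using that by (auto intro!: derivative_eq_intros)
    also have "- b - 1 = - (b + 1)" by simp
    finally show ?thesis by (simp add: g_def)
  qed
  have g': "(g has_real_derivative b * (b + 1) * y powr (- (b + 2))) (at y)" if "y > 0" for y
    unfolding g_def using that by (auto intro!: derivative_eq_intros simp: algebra_simps)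
  have g'_le: "\<bar>b * (b + 1) * y powr (- (b + 2))\<bar> \<le> b * (b + 1) * m" if "min 1 x \<le> y" for y
  proof -
    have "y powr (- (b + 2)) \<le> (min 1 x) powr (- (b + 2))"
      using that assms by (intro powr_mono2') auto
    also have "\<dots> \<le> m" by (auto simp: m_def min_def)
    finally show ?thesis using assms by (simp add: abs_mult)
  qed
  have g_le: "\<bar>g y\<bar> \<le> b * (b + 1) * m * \<bar>x - 1\<bar>" if "min 1 x \<le> y" "y \<le> max 1 x" for y
  proof -
    have "norm (g y - g 1) \<le> b * (b + 1) * m * norm (y - 1)"
    proof (rule field_differentiable_bound)
      fix w assume w: "w \<in> {min 1 x..max 1 x}"
      then show "(g has_real_derivative b * (b + 1) * w powr (- (b + 2))) (at w within {min 1 x..max 1 x})"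
        using assms by (intro has_field_derivative_at_within[OF g']) auto
      show "norm (b * (b + 1) * w powr (- (b + 2))) \<le> b * (b + 1) * m"
        using g'_le[of w] w by simp
    qed (use that in auto)
    also have "\<dots> \<le> b * (b + 1) * m * \<bar>x - 1\<bar>"
      using that assms by (intro mult_left_mono) (auto simp: m_def)
    finally show ?thesis by (simp add: g_def)
  qed
  have "norm (f x - f 1) \<le> b * (b + 1) * m * \<bar>x - 1\<bar> * norm (x - 1)"
  proof (rule field_differentiable_bound)
    fix w assume w: "w \<in> {min 1 x..max 1 x}"
    then show "(f has_real_derivative g w) (at w within {min 1 x..max 1 x})"
      using assms by (intro has_field_derivative_at_within[OF f']) auto
    show "norm (g w) \<le> b * (b + 1) * m * \<bar>x - 1\<bar>"
      using g_le[of w] w by simp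
  qed auto
  also have "\<dots> = b * (b + 1) * m * (\<bar>x - 1\<bar> * \<bar>x - 1\<bar>)" by simp
  also have "\<bar>x - 1\<bar> * \<bar>x - 1\<bar> = (x - 1)\<^sup>2" by (simp add: power2_eq_square)
  also have "b * (b + 1) * m * (x - 1)\<^sup>2 = b * (b + 1) * (x - 1)\<^sup>2 * m" by simp
  finally show ?thesis by (simp add: f_def m_def)
qed

section \<open>Logarithmic weights\<close>

text \<open>Both logarithmic factors are absorbed into \<open>(1 + 2 * ln s) powr B\<close> with
  \<open>B = b + 4\<close>. Then \<open>1 + u <= exp u\<close> at \<open>u = ln s / (2 * B)\<close>
  bounds the base by a multiple of \<open>s powr (1 / (2 * B))\<close>, whose \<open>B\<close>-th
  power is \<open>sqrt s\<close>.\<close>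

lemma log_power_le_sqrt:
  fixes s b :: real
  assumes "1 \<le> s" "b > 0"
  shows "(ln s)\<^sup>2 * (1 + 2 * ln s) powr (b + 2) \<le> (4 * (b + 4)) powr (b + 4) * sqrt s"
proof -
  define B where "B = b + 4"
  have B: "B > 4" using assms by (simp add: B_def)
  have ln: "0 \<le> ln s" using assms by simp
  have "(ln s)\<^sup>2 \<le> (1 + 2 * ln s)\<^sup>2" using ln by (intro power_mono) auto
  also have "\<dots> = (1 + 2 * ln s) powr 2" using ln by simp
  finally have "(ln s)\<^sup>2 * (1 + 2 * ln s) powr (b + 2) \<le> (1 + 2 * ln s) powr 2 * (1 + 2 * ln s) powr (b + 2)"
    by (intro mult_right_mono) auto
  also have "\<dots> = (1 + 2 * ln s) powr (2 + (b + 2))"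
    by (simp only: powr_add)
  also have "2 + (b + 2) = B" by (simp add: B_def)
  also have "(1 + 2 * ln s) powr B \<le> (4 * B * s powr (1 / (2 * B))) powr B"
  proof (rule powr_mono2)
    have "1 + 2 * ln s \<le> 4 * B + 2 * ln s" using B by simp
    also have "\<dots> = 4 * B * (1 + 1 / (2 * B) * ln s)" using B by (simp add: distrib_left)
    also have "\<dots> \<le> 4 * B * exp (1 / (2 * B) * ln s)"
      using B by (intro mult_left_mono exp_ge_add_one_self) auto
    also have "exp (1 / (2 * B) * ln s) = s powr (1 / (2 * B))"
      using assms by (simp add: powr_def)
    finally show "1 + 2 * ln s \<le> 4 * B * s powr (1 / (2 * B))" .
  qed (use ln B in auto)
  also have "\<dots> = (4 * B) powr B * (s powr (1 / (2 * B))) powr B"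
    by (rule powr_mult)
  also have "(s powr (1 / (2 * B))) powr B = s powr (1 / 2)"
    using B by (simp add: powr_powr)
  also have "\<dots> = sqrt s" using assms by (simp add: powr_half_sqrt)
  finally show ?thesis by (simp add: B_def)
qed

lemma ln_squared_le:
  fixes s :: real assumes "1 \<le> s"
  shows "(ln s)\<^sup>2 \<le> 4 * s"
proof -
  have "ln s = 2 * ln (sqrt s)" using assms by (simp add: ln_sqrt)
  also have "\<dots> \<le> 2 * sqrt s" using assms ln_bound[of "sqrt s"] by simp
  finally have "(ln s)\<^sup>2 \<le> (2 * sqrt s)\<^sup>2" using assms by (intro power_mono) auto
  then show ?thesis using assms by (simp add: power_mult_distrib)
qed

lemma L1_diff_le:
  assumes "1 \<le> k" "k \<le> j"
  shows "0 \<le> L1 (real j) - L1 (real k)" "L1 (real j) - L1 (real k) \<le> ln (real j / real k)"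
proof -
  show "0 \<le> L1 (real j) - L1 (real k)" using assms by (simp add: L1_def)
  have "(1 + real j) / (1 + real k) \<le> real j / real k"
    using assms by (simp add: field_simps)
  then have "ln ((1 + real j) / (1 + real k)) \<le> ln (real j / real k)"
    using assms by (intro ln_mono) auto
  then show "L1 (real j) - L1 (real k) \<le> ln (real j / real k)"
    using assms by (simp add: L1_def ln_div)
qed

lemma L1_ge_half:
  assumes "k \<ge> 1"
  shows "1 / 2 \<le> L1 (real k)"
proof -
  have "ln 2 \<le> ln (1 + real k)" using assms by (intro ln_mono) auto
  then show ?thesis using ln2_ge_two_thirds unfolding L1_def by linarith
qed

text \<open>The factor \<open>b * (b + 1)\<close> comes from the Taylor bound. Inside the maximum,
  \<open>4\<close> serves \<open>k > j\<close> through \<open>ln_squared_le\<close>, the other entry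
  \<open>k <= j\<close> through \<open>log_power_le_sqrt\<close>.\<close>

definition taylor_const :: "real \<Rightarrow> real" where
  "taylor_const b = b * (b + 1) * max 4 ((4 * (b + 4)) powr (b + 4))"

text \<open>Taylor's bound at \<open>x = L1 k / L1 j\<close>, multiplied by \<open>L1 j\<close>,
  leaves \<open>(L1 k - L1 j)^2 / L1 j\<close> times a power of the ratio. Differences of
  \<open>L1\<close> are at most \<open>ln\<close> of the quotient of the indices, so
  \<open>weight\<close> dominates.\<close>

lemma L1_taylor_error:
  assumes b: "b > 0" and k: "k \<ge> 1" and j: "j \<ge> 1"
  shows "\<bar>L1 (real j) * ((L1 (real j) / L1 (real k)) powr b - 1) + b * (L1 (real k) - L1 (real j))\<bar>
    \<le> taylor_const b / L1 (real j) * weight j k"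
proof -
  define p where "p = L1 (real j)"
  define q where "q = L1 (real k)"
  have pq: "p > 0" "q > 0" using j k by (auto simp: p_def q_def intro!: L1_pos)
  define K where "K = max 4 ((4 * (b + 4)) powr (b + 4))"
  have main: "(q - p)\<^sup>2 * max 1 ((p / q) powr (b + 2)) \<le> K * weight j k"
  proof (cases "k \<le> j")
    case True
    define s where "s = real j / real k"
    have s: "1 \<le> s" using True k by (simp add: s_def)
    have d: "0 \<le> p - q" "p - q \<le> ln s"
      using L1_diff_le[OF k True] by (auto simp: p_def q_def s_def)
    \<comment> \<open>\<open>L1\<close> is at least \<open>1 / 2\<close> on positive integers, so
      the ratio grows at most logarithmically in \<open>j / k\<close>.\<close>
    have "p / q = 1 + (p - q) / q" using pq by (simp add: field_simps)
    also have "(p - q) / q \<le> ln s / (1 / 2)"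
      using d L1_ge_half[OF k] pq by (intro frac_le) (auto simp: q_def)
    finally have le: "p / q \<le> 1 + 2 * ln s" by simp
    have "max 1 ((p / q) powr (b + 2)) \<le> (1 + 2 * ln s) powr (b + 2)"
      using le s b pq by (intro max.boundedI powr_mono2 ge_one_powr_ge_zero) auto
    moreover have "(q - p)\<^sup>2 \<le> (ln s)\<^sup>2"
      using d by (subst power2_commute) (intro power_mono)
    ultimately have "(q - p)\<^sup>2 * max 1 ((p / q) powr (b + 2)) \<le> (ln s)\<^sup>2 * (1 + 2 * ln s) powr (b + 2)"
      by (intro mult_mono) auto
    also have "\<dots> \<le> (4 * (b + 4)) powr (b + 4) * sqrt s" by (rule log_power_le_sqrt[OF s b])
    also have "\<dots> \<le> K * sqrt s" using s by (intro mult_right_mono) (auto simp: K_def)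
    finally show ?thesis using True by (simp add: weight_def s_def)
  next
    case False
    define s where "s = real k / real j"
    have s: "1 \<le> s" using False j by (simp add: s_def)
    have d: "0 \<le> q - p" "q - p \<le> ln s"
      using L1_diff_le[OF j, of k] False by (auto simp: p_def q_def s_def)
    have "(p / q) powr (b + 2) \<le> 1"
      using d pq b by (intro powr_le1) auto
    then have "(q - p)\<^sup>2 * max 1 ((p / q) powr (b + 2)) = (q - p)\<^sup>2" by simp
    also have "\<dots> \<le> (ln s)\<^sup>2" using d by (intro power_mono)
    also have "\<dots> \<le> 4 * s" by (rule ln_squared_le[OF s])
    also have "\<dots> \<le> K * s" using s by (intro mult_right_mono) (auto simp: K_def)
    finally show ?thesis using False by (simp add: weight_def s_def)
  qed
  have pw: "(q / p) powr (- r) = (p / q) powr r" for r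
    using pq by (simp add: powr_minus powr_divide)
  have "p * ((p / q) powr b - 1) + b * (q - p) = p * ((q / p) powr (- b) - 1 + b * (q / p - 1))"
  proof -
    have "p * (b * (q / p - 1)) = b * (q - p)" using pq by (simp add: field_simps)
    then show ?thesis by (simp only: pw distrib_left)
  qed
  then have "\<bar>p * ((p / q) powr b - 1) + b * (q - p)\<bar> = p * \<bar>(q / p) powr (- b) - 1 + b * (q / p - 1)\<bar>"
    using pq by (simp add: abs_mult)
  also have "\<dots> \<le> p * (b * (b + 1) * (q / p - 1)\<^sup>2 * max 1 ((q / p) powr (- (b + 2))))"
    using pq b by (intro mult_left_mono powr_taylor_bound) auto
  also have "\<dots> = b * (b + 1) / p * ((q - p)\<^sup>2 * max 1 ((p / q) powr (b + 2)))"
  proof -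
    have "q / p - 1 = (q - p) / p" using pq by (simp add: field_simps)
    then have "p * (q / p - 1)\<^sup>2 = (q - p)\<^sup>2 / p" using pq by (simp add: power_divide power2_eq_square)
    then have "b * (b + 1) * (p * (q / p - 1)\<^sup>2) * max 1 ((q / p) powr (- (b + 2))) =
        b * (b + 1) * ((q - p)\<^sup>2 / p) * max 1 ((p / q) powr (b + 2))"
      unfolding pw by simp
    then show ?thesis by (simp add: mult_ac)
  qed
  also have "\<dots> \<le> b * (b + 1) / p * (K * weight j k)"
    using main b pq by (intro mult_left_mono) auto
  finally show ?thesis by (simp add: p_def q_def K_def taylor_const_def mult_ac)
qed

text \<open>The difference is at most the reciprocal of the smaller index. For \<open>k <= j\<close>
  this is at most \<open>1 / sqrt k\<close>, exactly the right-hand side; for \<open>k > j\<close>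
  the weight is at least \<open>1\<close>.\<close>

lemma harm_L1_error:
  assumes k: "k \<ge> 1" and j: "j \<ge> 1"
  shows "\<bar>(harm k - L1 (real k)) - (harm j - L1 (real j))\<bar> \<le> 1 / sqrt (real j) * weight j k"
proof (cases "k \<le> j")
  case True
  have "\<bar>(harm k - L1 (real k)) - (harm j - L1 (real j))\<bar> \<le> 1 / real k - 1 / real j"
    using harm_minus_ln_bounds[OF k True] by simp
  also have "\<dots> \<le> 1 / real k" by simp
  also have "\<dots> \<le> 1 / sqrt (real k)"
  proof (intro divide_left_mono)
    have "real k \<le> (real k)\<^sup>2" using k by (simp add: power2_eq_square)
    then show "sqrt (real k) \<le> real k" by (rule real_le_lsqrt[rotated]) simp
  qed (use k in auto)
  also have "\<dots> = 1 / sqrt (real j) * weight j k"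
    using True j k by (simp add: weight_def real_sqrt_divide)
  finally show ?thesis .
next
  case False
  have "\<bar>(harm k - L1 (real k)) - (harm j - L1 (real j))\<bar> \<le> 1 / real j - 1 / real k"
    using harm_minus_ln_bounds[OF j, of k] False by simp
  also have "\<dots> \<le> 1 / real j" by simp
  also have "\<dots> \<le> 1 / sqrt (real j)"
  proof (intro divide_left_mono)
    have "real j \<le> (real j)\<^sup>2" using j by (simp add: power2_eq_square)
    then show "sqrt (real j) \<le> real j" by (rule real_le_lsqrt[rotated]) simp
  qed (use j in auto)
  also have "\<dots> \<le> 1 / sqrt (real j) * weight j k"
    using False j by (simp add: weight_def field_simps)
  finally show ?thesis .
qed

text \<open>The remainder collects the second-order Taylor error of \<open>x powr (- b)\<close> at
  \<open>x = L1 k / L1 j\<close> and the error of replacing \<open>L1\<close> by the harmonic numbers.\<close>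

lemma weighted_cutoff_expansion:
  assumes b: "b > 0" and t: "0 < t" "t < 1" and j: "j \<ge> 1"
  defines "s \<equiv> harm j + ln t"
  defines "w \<equiv> \<lambda>k. (L1 (real j) / L1 (real k)) powr b"
  obtains R where
    "(\<lambda>k. L1 (real j) * w k / real k * cutoff j (1 - t) k) sums
      (L1 (real j) * s - b * ((\<Sum>k\<le>j. 1 / (real k)\<^sup>2) / 2 - dilog (1 - t) - s\<^sup>2 / 2) + R)"
    "\<bar>R\<bar> \<le> (taylor_const b / L1 (real j) + b / sqrt (real j)) * (2 * (t * real j) + 1 / (t * real j))"
proof -
  \<comment> \<open>Chosen so that \<open>L1 j * w k = L1 j - b * (harm k - harm j) + E k\<close>:
    the first two terms yield the closed forms, and \<open>E\<close> the remainder.\<close>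
  define E where "E k = L1 (real j) * (w k - 1) + b * (harm k - harm j)" for k
  have tc: "taylor_const b \<ge> 0" using b by (auto simp: taylor_const_def)
  have \<epsilon>: "taylor_const b / L1 (real j) + b / sqrt (real j) \<ge> 0"
    using b tc L1_pos[of "real j"] j by simp
  have E: "\<bar>E k\<bar> \<le> (taylor_const b / L1 (real j) + b / sqrt (real j)) * weight j k" if k: "k \<ge> 1" for k
  proof -
    have "E k = (L1 (real j) * (w k - 1) + b * (L1 (real k) - L1 (real j))) +
        b * ((harm k - L1 (real k)) - (harm j - L1 (real j)))"
      by (simp add: E_def algebra_simps)
    also have "\<bar>\<dots>\<bar> \<le> \<bar>L1 (real j) * (w k - 1) + b * (L1 (real k) - L1 (real j))\<bar> +
        b * \<bar>(harm k - L1 (real k)) - (harm j - L1 (real j))\<bar>"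
      using b by (intro order_trans[OF abs_triangle_ineq]) (simp add: abs_mult)
    also have "\<dots> \<le> taylor_const b / L1 (real j) * weight j k + b * (1 / sqrt (real j) * weight j k)"
      unfolding w_def using b k j by (intro add_mono mult_left_mono L1_taylor_error harm_L1_error) auto
    finally show ?thesis by (simp add: algebra_simps)
  qed
  note err = cutoff_error_bound[OF t j \<epsilon> E]
  define R where "R = (\<Sum>k. E k / real k * cutoff j (1 - t) k)"
  have "(\<lambda>k. E k / real k * cutoff j (1 - t) k) sums R"
    unfolding R_def by (rule summable_sums[OF err(1)])
  from sums_add[OF sums_diff[OF sums_mult[OF cutoff_ln_sums[OF t, of j], of "L1 (real j)"]
      sums_mult[OF cutoff_harm_sums[OF t, of j], of b]] this]
  have "(\<lambda>k. L1 (real j) * (1 / real k * cutoff j (1 - t) k) -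
      b * ((harm k - harm j) / real k * cutoff j (1 - t) k) + E k / real k * cutoff j (1 - t) k) sums
    (L1 (real j) * s - b * ((\<Sum>k\<le>j. 1 / (real k)\<^sup>2) / 2 - dilog (1 - t) - s\<^sup>2 / 2) + R)"
    by (simp add: s_def)
  moreover have "L1 (real j) * (1 / real k * cutoff j (1 - t) k) -
      b * ((harm k - harm j) / real k * cutoff j (1 - t) k) + E k / real k * cutoff j (1 - t) k =
      L1 (real j) * w k / real k * cutoff j (1 - t) k" for k
  proof -
    have "L1 (real j) * w k = L1 (real j) - b * (harm k - harm j) + E k"
      by (simp add: E_def algebra_simps)
    then show ?thesis
      by (simp only:) (simp add: add_divide_distrib diff_divide_distrib algebra_simps)
  qed
  ultimately show ?thesis
    using that[of R] err(2) by (simp add: R_def)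
qed

text \<open>Here \<open>t\<close> is a trial tail with a free second-order coefficient
  \<open>\<eta>\<close>. With \<open>s = harm j + ln t\<close>, \<open>L1 j * s\<close> tends to
  \<open>\<eta>\<close>, hence \<open>s\<close> to \<open>0\<close>, and the dilogarithmic bracket
  tends to \<open>pi^2 / 12 - pi^2 / 6\<close>. The remainder vanishes because \<open>t * j\<close>
  has a positive limit.\<close>

lemma weighted_cutoff_LIMSEQ:
  fixes b \<eta> :: real and D :: "nat \<Rightarrow> real"
  assumes b: "b > 0"
  defines "t \<equiv> \<lambda>j. exp (- euler_mascheroni) / real j * (1 + \<eta> / ln (real j))"
  assumes D: "\<And>j. j \<ge> 1 \<Longrightarrow> 0 < t j \<Longrightarrow> t j < 1 \<Longrightarrow>
    (\<lambda>k. L1 (real j) * (L1 (real j) / L1 (real k)) powr b / real k * cutoff j (1 - t j) k) sums D j"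
  shows "D \<longlonglongrightarrow> \<eta> + b * pi\<^sup>2 / 12" "\<forall>\<^sub>F j in sequentially. 0 < t j \<and> t j < 1"
proof -
  define c :: real where "c = exp (- euler_mascheroni)"
  have c: "c > 0" by (simp add: c_def)
  have ln0: "(\<lambda>j. \<eta> / ln (real j)) \<longlonglongrightarrow> 0"
    by (rule tendsto_divide_0[OF tendsto_const])
       (intro filterlim_at_top_imp_at_infinity filterlim_compose[OF ln_at_top filterlim_real_sequentially])
  have tj: "(\<lambda>j. t j * real j) \<longlonglongrightarrow> c"
  proof (rule Lim_transform_eventually)
    show "(\<lambda>j. c * (1 + \<eta> / ln (real j))) \<longlonglongrightarrow> c"
      using tendsto_mult[OF tendsto_const tendsto_add[OF tendsto_const ln0], of c 1] by simp
    show "\<forall>\<^sub>F j in sequentially. c * (1 + \<eta> / ln (real j)) = t j * real j"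
      using eventually_gt_at_top[of 0] by eventually_elim (simp add: t_def c_def)
  qed
  have t0: "t \<longlonglongrightarrow> 0"
  proof (rule Lim_transform_eventually)
    show "(\<lambda>j. t j * real j * (1 / real j)) \<longlonglongrightarrow> 0"
      using tendsto_mult[OF tj lim_1_over_n] by simp
    show "\<forall>\<^sub>F j in sequentially. t j * real j * (1 / real j) = t j"
      using eventually_gt_at_top[of 0] by eventually_elim simp
  qed
  have pos: "\<forall>\<^sub>F j in sequentially. 0 < t j * real j"
    by (rule order_tendstoD(1)[OF tj c])
  show ev: "\<forall>\<^sub>F j in sequentially. 0 < t j \<and> t j < 1"
    using pos order_tendstoD(2)[OF t0 zero_less_one] eventually_gt_at_top[of 0]
    by eventually_elim (auto simp: zero_less_mult_iff)
  define s where "s j = harm j + ln (t j)" for j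
  have s_eq: "\<forall>\<^sub>F j in sequentially. s j = (harm j - ln (real j) - euler_mascheroni) + ln (1 + \<eta> / ln (real j))"
    using pos eventually_gt_at_top[of 0]
  proof eventually_elim
    case (elim j)
    then have "1 + \<eta> / ln (real j) > 0" by (simp add: t_def zero_less_mult_iff)
    then have "ln (t j) = ln (exp (- euler_mascheroni)) - ln (real j) + ln (1 + \<eta> / ln (real j))"
      unfolding t_def using elim by (subst ln_mult) (auto simp: ln_div)
    then show ?case by (simp add: s_def)
  qed
  have Ls: "(\<lambda>j. L1 (real j) * s j) \<longlonglongrightarrow> \<eta>"
  proof (rule Lim_transform_eventually)
    show "(\<lambda>j. L1 (real j) * (harm j - ln (real j) - euler_mascheroni) + L1 (real j) * ln (1 + \<eta> / ln (real j))) \<longlonglongrightarrow> \<eta>"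
      using tendsto_add[OF L1_harm_minus_ln ln_times_ln_one_plus_LIMSEQ[of \<eta>]] by (simp add: L1_def)
    show "\<forall>\<^sub>F j in sequentially. L1 (real j) * (harm j - ln (real j) - euler_mascheroni) +
        L1 (real j) * ln (1 + \<eta> / ln (real j)) = L1 (real j) * s j"
      using s_eq by eventually_elim (simp only: distrib_left)
  qed
  have L1_inf: "filterlim (\<lambda>j. L1 (real j)) at_top sequentially"
    unfolding L1_def by real_asymp
  have L1_inv: "(\<lambda>j. a / L1 (real j)) \<longlonglongrightarrow> 0" for a
    by (rule tendsto_divide_0[OF tendsto_const filterlim_at_top_imp_at_infinity[OF L1_inf]])
  have s0: "s \<longlonglongrightarrow> 0"
  proof (rule Lim_transform_eventually)
    show "(\<lambda>j. L1 (real j) * s j * (1 / L1 (real j))) \<longlonglongrightarrow> 0"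
      using tendsto_mult[OF Ls L1_inv[of 1]] by simp
    show "\<forall>\<^sub>F j in sequentially. L1 (real j) * s j * (1 / L1 (real j)) = s j"
      using eventually_gt_at_top[of 0]
    proof eventually_elim
      case (elim j)
      then have "L1 (real j) > 0" by (intro L1_pos) simp
      then show ?case by simp
    qed
  qed
  have H2: "(\<lambda>j. \<Sum>k\<le>j. 1 / (real k)\<^sup>2) \<longlonglongrightarrow> pi\<^sup>2 / 6"
    using inverse_squares_sums' unfolding sums_def_le .
  have dl: "(\<lambda>j. dilog (1 - t j)) \<longlonglongrightarrow> pi\<^sup>2 / 6"
    unfolding dilog_1[symmetric]
  proof (rule continuous_on_tendsto_compose[OF continuous_on_dilog])
    show "(\<lambda>j. 1 - t j) \<longlonglongrightarrow> 1" using tendsto_diff[OF tendsto_const t0, of 1] by simp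
    show "\<forall>\<^sub>F j in sequentially. 1 - t j \<in> {0..1}" using ev by eventually_elim auto
  qed simp
  define M where "M j = L1 (real j) * s j - b * ((\<Sum>k\<le>j. 1 / (real k)\<^sup>2) / 2 - dilog (1 - t j) - (s j)\<^sup>2 / 2)" for j
  have "M \<longlonglongrightarrow> \<eta> - b * (pi\<^sup>2 / 6 / 2 - pi\<^sup>2 / 6 - 0\<^sup>2 / 2)"
    unfolding M_def by (intro tendsto_intros Ls H2 dl s0) auto
  then have M: "M \<longlonglongrightarrow> \<eta> + b * pi\<^sup>2 / 12" by (simp add: field_simps)
  have "(\<lambda>j. (taylor_const b / L1 (real j) + b / sqrt (real j)) * (2 * (t j * real j) + 1 / (t j * real j))) \<longlonglongrightarrow>
      (0 + 0) * (2 * c + 1 / c)"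
  proof -
    have "(\<lambda>j. b / sqrt (real j)) \<longlonglongrightarrow> 0" by real_asymp
    then show ?thesis using c by (intro tendsto_intros L1_inv tj) auto
  qed
  then have bnd: "(\<lambda>j. (taylor_const b / L1 (real j) + b / sqrt (real j)) * (2 * (t j * real j) + 1 / (t j * real j))) \<longlonglongrightarrow> 0"
    by simp
  have "(\<lambda>j. D j - M j) \<longlonglongrightarrow> 0"
  proof (rule Lim_null_comparison[OF _ bnd])
    show "\<forall>\<^sub>F j in sequentially. norm (D j - M j) \<le>
        (taylor_const b / L1 (real j) + b / sqrt (real j)) * (2 * (t j * real j) + 1 / (t j * real j))"
      using ev eventually_ge_at_top[of 1]
    proof eventually_elim
      case (elim j)
      obtain R where "(\<lambda>k. L1 (real j) * (L1 (real j) / L1 (real k)) powr b / real k * cutoff j (1 - t j) k) sums (M j + R)"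
        "\<bar>R\<bar> \<le> (taylor_const b / L1 (real j) + b / sqrt (real j)) * (2 * (t j * real j) + 1 / (t j * real j))"
        unfolding M_def s_def
        by (rule weighted_cutoff_expansion[OF b, of "t j" j]) (use elim in \<open>blast+\<close>)
      moreover have "D j = M j + R" using calculation(1) D[of j] elim sums_unique2 by blast
      ultimately show ?case by simp
    qed
  qed
  from tendsto_add[OF this M] show "D \<longlonglongrightarrow> \<eta> + b * pi\<^sup>2 / 12" by simp
qed

section \<open>Tail of the branching number\<close>

lemma tail_LIMSEQ_0: "tail p \<longlonglongrightarrow> 0"
  using tendsto_diff[OF tendsto_const cdf_nat_LIMSEQ, of 1 p] by (simp add: tail_eq[abs_def])

lemma tail_Suc: "tail p (Suc j) = tail p j - pmf p (Suc j)"
  by (simp add: tail_eq cdf_nat_Suc)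

lemma eventually_mono_to_0:
  fixes h :: "nat \<Rightarrow> real"
  assumes "h \<longlonglongrightarrow> 0" "\<forall>\<^sub>F k in sequentially. h k \<le> h (Suc k)"
  shows "\<forall>\<^sub>F k in sequentially. h k \<le> 0"
proof -
  obtain N where N: "\<And>k. k \<ge> N \<Longrightarrow> h k \<le> h (Suc k)"
    using assms(2) by (auto simp: eventually_at_top_linorder)
  have "h k \<le> 0" if "k \<ge> N" for k
  proof (rule tendsto_lowerbound[OF assms(1)])
    have "h k \<le> h n" if "n \<ge> k" for n
      using that by (induction rule: dec_induct) (use N \<open>k \<ge> N\<close> in \<open>auto intro: order_trans\<close>)
    then show "\<forall>\<^sub>F n in sequentially. h k \<le> h n" by (auto simp: eventually_at_top_linorder)
  qed simp
  then show ?thesis by (auto simp: eventually_at_top_linorder)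
qed

text \<open>Stolz-Cesaro in the form 0/0. For \<open>m\<close> strictly between \<open>l\<close> and
  \<open>a\<close>, the difference of the tail and \<open>m * f\<close> is eventually monotone with
  limit \<open>0\<close>, so it has a fixed sign.\<close>

lemma LIMSEQ_ratio_tail:
  fixes f :: "nat \<Rightarrow> real"
  assumes f: "f \<longlonglongrightarrow> 0" "\<forall>\<^sub>F k in sequentially. f k > f (Suc k)"
    and r: "(\<lambda>k. pmf p (Suc k) / (f k - f (Suc k))) \<longlonglongrightarrow> l"
  shows "(\<lambda>j. tail p j / f j) \<longlonglongrightarrow> l"
proof -
  have f_pos: "\<forall>\<^sub>F k in sequentially. f k > 0"
  proof -
    have "\<forall>\<^sub>F k in sequentially. - f k \<le> 0"
      by (rule eventually_mono_to_0) (use tendsto_minus[OF f(1)] f(2) in \<open>auto elim: eventually_mono\<close>)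
    then have "\<forall>\<^sub>F k in sequentially. - f (Suc k) \<le> 0" using eventually_all_ge_at_top eventually_sequentially_Suc[of "\<lambda>k. - f k \<le> 0"] by blast
    with f(2) show ?thesis by eventually_elim simp
  qed
  show ?thesis
  proof (rule order_tendstoI)
    fix a assume "l < a"
    then obtain m where m: "l < m" "m < a" using dense by blast
    have "\<forall>\<^sub>F j in sequentially. tail p j - m * f j \<le> 0"
    proof (rule eventually_mono_to_0)
      show "(\<lambda>j. tail p j - m * f j) \<longlonglongrightarrow> 0"
        using tendsto_diff[OF tail_LIMSEQ_0 tendsto_mult[OF tendsto_const f(1)], of p m] by simp
      show "\<forall>\<^sub>F k in sequentially. tail p k - m * f k \<le> tail p (Suc k) - m * f (Suc k)"
        using order_tendstoD(2)[OF r m(1)] f(2)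
        by eventually_elim (simp add: tail_Suc field_simps)
    qed
    then show "\<forall>\<^sub>F j in sequentially. tail p j / f j < a"
      using f_pos
    proof eventually_elim
      case (elim j)
      then have "tail p j \<le> m * f j" by simp
      also have "\<dots> < a * f j" using elim m by (intro mult_strict_right_mono) auto
      finally show ?case using elim by (simp add: field_simps)
    qed
  next
    fix a assume "a < l"
    then obtain m where m: "a < m" "m < l" using dense by blast
    have "\<forall>\<^sub>F j in sequentially. m * f j - tail p j \<le> 0"
    proof (rule eventually_mono_to_0)
      show "(\<lambda>j. m * f j - tail p j) \<longlonglongrightarrow> 0"
        using tendsto_diff[OF tendsto_mult[OF tendsto_const f(1)] tail_LIMSEQ_0, of m p] by simp
      show "\<forall>\<^sub>F k in sequentially. m * f k - tail p k \<le> m * f (Suc k) - tail p (Suc k)"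
        using order_tendstoD(1)[OF r m(2)] f(2)
        by eventually_elim (simp add: tail_Suc field_simps)
    qed
    then show "\<forall>\<^sub>F j in sequentially. a < tail p j / f j"
      using f_pos
    proof eventually_elim
      case (elim j)
      have "a * f j < m * f j" using elim m by (intro mult_strict_right_mono) auto
      also have "\<dots> \<le> tail p j" using elim by simp
      finally show ?case using elim by (simp add: field_simps)
    qed
  qed
qed

lemma moment_ge_tail:
  assumes "q > 0"
  shows "ennreal (real j powr q * tail p j) \<le> (\<integral>\<^sup>+x. ennreal (real x powr q) \<partial>measure_pmf p)"
proof -
  have "ennreal (real j powr q * tail p j) = (\<integral>\<^sup>+x. ennreal (real j powr q) * indicator {j<..} x \<partial>measure_pmf p)"
    by (simp add: nn_integral_cmult_indicator tail_def measure_pmf.emeasure_eq_measure ennreal_mult)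
  also have "\<dots> \<le> (\<integral>\<^sup>+x. ennreal (real x powr q) \<partial>measure_pmf p)"
    using assms by (intro nn_integral_mono) (auto simp: indicator_def intro!: ennreal_leI powr_mono2)
  finally show ?thesis .
qed

section \<open>The law with logarithmically decaying tail and its branching number\<close>

locale log_tail_law =
  fixes \<beta> C0 :: real and X :: "nat pmf"
  assumes \<beta>: "\<beta> > 0" and C0: "C0 > 0" and set_X: "set_pmf X \<subseteq> {1..}"
    and pmf_X: "\<And>j. j \<ge> 1 \<Longrightarrow> pmf X j = C0 / (real j * L1 (real j) powr (\<beta> + 1))"
begin

lemma tail_ratio: "(\<lambda>j. tail X j / L1 (real j) powr (- \<beta>)) \<longlonglongrightarrow> C0 / \<beta>"
proof (rule LIMSEQ_ratio_tail)
  show "(\<lambda>j. L1 (real j) powr (- \<beta>)) \<longlonglongrightarrow> 0"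
    using \<beta> unfolding L1_def by real_asymp
  show "\<forall>\<^sub>F k in sequentially. L1 (real (Suc k)) powr (- \<beta>) < L1 (real k) powr (- \<beta>)"
    using eventually_gt_at_top[of 0]
    by eventually_elim (use \<beta> in \<open>auto simp: L1_def intro!: powr_less_mono2_neg\<close>)
  have "(\<lambda>k. C0 * ((1 / (real (Suc k) * ln (1 + real (Suc k)) powr (\<beta> + 1))) /
    (ln (real (Suc k)) powr (- \<beta>) - ln (1 + real (Suc k)) powr (- \<beta>)))) \<longlonglongrightarrow> C0 * (1 / \<beta>)"
    by (intro tendsto_mult tendsto_const LIMSEQ_Suc[OF ln_powr_increment_ratio[OF \<beta>]])
  then show "(\<lambda>k. pmf X (Suc k) / (L1 (real k) powr (- \<beta>) - L1 (real (Suc k)) powr (- \<beta>))) \<longlonglongrightarrow> C0 / \<beta>"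
    by (simp add: pmf_X L1_def)
qed

text \<open>The factor \<open>1 / \<beta>\<close> comes from summing
  \<open>1 / (k * L1 k powr (\<beta> + 1))\<close> over \<open>k > j\<close>; the constant is
  \<open>C0\<close> itself only for \<open>\<beta> = 1\<close>.\<close>

lemma tail_asymp: "tail X \<sim>[at_top] (\<lambda>j. C0 / \<beta> * L1 (real j) powr (- \<beta>))"
proof (rule asymp_equivI')
  have "(\<lambda>j. tail X j / L1 (real j) powr (- \<beta>) / (C0 / \<beta>)) \<longlonglongrightarrow> C0 / \<beta> / (C0 / \<beta>)"
    by (rule tendsto_divide[OF tail_ratio tendsto_const]) (use \<beta> C0 in auto)
  then show "(\<lambda>j. tail X j / (C0 / \<beta> * L1 (real j) powr (- \<beta>))) \<longlonglongrightarrow> 1"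
    using \<beta> C0 by (simp add: mult_ac)
qed

lemma tail_heavy:
  assumes "a > 0"
  shows "filterlim (\<lambda>j. tail X j / real j powr (- a)) at_top at_top"
proof -
  have "filterlim (\<lambda>j. L1 (real j) powr (- \<beta>) * real j powr a) at_top sequentially"
    using \<beta> assms unfolding L1_def by real_asymp
  from filterlim_tendsto_pos_mult_at_top[OF tail_ratio _ this] \<beta> C0 have "filterlim (\<lambda>j. tail X j / L1 (real j) powr (- \<beta>) * (L1 (real j) powr (- \<beta>) * real j powr a)) at_top sequentially"
    by simp
  then show ?thesis
  proof (rule filterlim_mono_eventually)
    show "\<forall>\<^sub>F j in sequentially. tail X j / L1 (real j) powr (- \<beta>) * (L1 (real j) powr (- \<beta>) * real j powr a) =
        tail X j / real j powr (- a)"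
      using eventually_gt_at_top[of 0]
    proof eventually_elim
      case (elim j)
      then have "L1 (real j) > 0" by (intro L1_pos) simp
      then show ?case by (simp add: powr_minus divide_inverse)
    qed
  qed auto
qed

lemma moment_infinite:
  assumes "q > 0"
  shows "(\<integral>\<^sup>+x. ennreal (real x powr q) \<partial>measure_pmf X) = \<infinity>"
proof (rule ccontr)
  assume "(\<integral>\<^sup>+x. ennreal (real x powr q) \<partial>measure_pmf X) \<noteq> \<infinity>"
  then obtain B where B: "B \<ge> 0" "(\<integral>\<^sup>+x. ennreal (real x powr q) \<partial>measure_pmf X) = ennreal B"
    by (cases "\<integral>\<^sup>+x. ennreal (real x powr q) \<partial>measure_pmf X") auto
  have "\<forall>\<^sub>F j in sequentially. B < tail X j / real j powr (- q)"
    using tail_heavy[OF assms] by (simp add: filterlim_at_top_dense)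
  then obtain j where "B < real j powr q * tail X j"
    by (auto simp: eventually_at_top_linorder powr_minus field_simps)
  moreover have "ennreal (real j powr q * tail X j) \<le> ennreal B"
    using moment_ge_tail[OF assms, of j X] B by simp
  ultimately show False using B by simp
qed

lemma set_pmf_eq_atLeast: "set_pmf X = {1..}"
proof -
  have "pmf X j > 0" if "j \<ge> 1" for j
    using that C0 L1_pos[of "real j"] by (simp add: pmf_X)
  then show ?thesis using set_X by (force simp: set_pmf_iff)
qed

text \<open>The positive prefactor turns the masses of \<open>X\<close> into the weights of the
  cutoff expansion with \<open>b = \<beta> + 1\<close>, without changing the sign of the
  difference.\<close>

lemma scaled_cutoff_sums:
  assumes j: "j \<ge> 1" and t: "0 < t" "t < 1"
  shows "(\<lambda>k. L1 (real j) * (L1 (real j) / L1 (real k)) powr (\<beta> + 1) / real k * cutoff j (1 - t) k) sums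
    (L1 (real j) * L1 (real j) powr (\<beta> + 1) / C0 * (cdf_nat X j - pgf X (1 - t)))"
proof -
  have "(\<lambda>k. pmf X k * cutoff j (1 - t) k) sums (cdf_nat X j - pgf X (1 - t))"
    using cutoff_sums[OF pgf_sums[of "1 - t" X], of j] t by (simp add: cdf_nat_eq_sum)
  from sums_mult[OF this, of "L1 (real j) * L1 (real j) powr (\<beta> + 1) / C0"]
  have "(\<lambda>k. L1 (real j) * L1 (real j) powr (\<beta> + 1) / C0 * (pmf X k * cutoff j (1 - t) k)) sums
    (L1 (real j) * L1 (real j) powr (\<beta> + 1) / C0 * (cdf_nat X j - pgf X (1 - t)))" .
  moreover have "L1 (real j) * L1 (real j) powr (\<beta> + 1) / C0 * (pmf X k * cutoff j (1 - t) k) =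
      L1 (real j) * (L1 (real j) / L1 (real k)) powr (\<beta> + 1) / real k * cutoff j (1 - t) k" for k
  proof (cases "k = 0")
    case True
    \<comment> \<open>The formula for \<open>pmf X\<close> starts at \<open>1\<close>; at
      \<open>0\<close> one side vanishes by the support of \<open>X\<close>, the other by division
      by zero.\<close>
    then have "pmf X k = 0" using set_X by (auto simp: set_pmf_iff)
    then show ?thesis using True by simp
  next
    case False
    then have "L1 (real j) > 0" "L1 (real k) > 0" using j by (auto intro: L1_pos)
    then show ?thesis using False C0 by (simp add: pmf_X powr_divide mult_ac)
  qed
  ultimately show ?thesis by simp
qed

text \<open>Evaluating the strictly monotone \<open>pgf X\<close> at the trial point \<open>1 - t j\<close> compares \<open>t j\<close> with
  \<open>tail \<nu> j\<close>; the sign of \<open>\<eta> + (\<beta> + 1) \<pi>\<^sup>2 / 12\<close> decides.\<close>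

lemma branching_tail_trap:
  fixes \<eta> :: real
  assumes \<nu>: "branching_law X \<nu>"
  defines "t \<equiv> \<lambda>j. exp (- euler_mascheroni) / real j * (1 + \<eta> / ln (real j))"
  shows "\<eta> > - ((\<beta> + 1) * pi\<^sup>2 / 12) \<Longrightarrow> \<forall>\<^sub>F j in sequentially. tail \<nu> j < t j"
    and "\<eta> < - ((\<beta> + 1) * pi\<^sup>2 / 12) \<Longrightarrow> \<forall>\<^sub>F j in sequentially. t j < tail \<nu> j"
proof -
  define D where "D j = L1 (real j) * L1 (real j) powr (\<beta> + 1) / C0 * (cdf_nat X j - pgf X (1 - t j))" for j
  have "\<beta> + 1 > 0" using \<beta> by simp
  note lim = weighted_cutoff_LIMSEQ[OF this, of \<eta> D]
  have sums: "(\<lambda>k. L1 (real j) * (L1 (real j) / L1 (real k)) powr (\<beta> + 1) / real k * cutoff j (1 - t j) k) sums D j"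
    if "j \<ge> 1" "0 < t j" "t j < 1" for j
    unfolding D_def by (rule scaled_cutoff_sums[OF that])
  have D: "D \<longlonglongrightarrow> \<eta> + (\<beta> + 1) * pi\<^sup>2 / 12" and ev: "\<forall>\<^sub>F j in sequentially. 0 < t j \<and> t j < 1"
    using lim[OF sums[unfolded t_def]] unfolding t_def by simp_all
  note smo = pgf_strict_mono_on[OF set_X]
  have compare: "tail \<nu> j < t j \<longleftrightarrow> D j > 0" "t j < tail \<nu> j \<longleftrightarrow> D j < 0"
    if j: "j \<ge> 1" "0 < t j" "t j < 1" for j
  proof -
    have K: "L1 (real j) * L1 (real j) powr (\<beta> + 1) / C0 > 0"
      using j C0 L1_pos[of "real j"] by simp
    \<comment> \<open>The defining equation makes \<open>D j\<close> a positive multiple of a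
      difference of two values of \<open>pgf X\<close>, so its sign compares the arguments.\<close>
    have cdf: "cdf_nat X j = pgf X (cdf_nat \<nu> j)" using \<nu> j by (simp add: branching_law_def)
    have mem: "1 - t j \<in> {0..1}" "cdf_nat \<nu> j \<in> {0..1}"
      using j by (auto simp: cdf_nat_nonneg cdf_nat_le_1)
    have "D j > 0 \<longleftrightarrow> pgf X (1 - t j) < pgf X (cdf_nat \<nu> j)"
      using K unfolding D_def cdf by (simp only: zero_less_mult_iff) auto
    also have "\<dots> \<longleftrightarrow> tail \<nu> j < t j"
      using strict_mono_on_less[OF smo mem] by (auto simp: tail_eq)
    finally show "tail \<nu> j < t j \<longleftrightarrow> D j > 0" by simp
    have "D j < 0 \<longleftrightarrow> pgf X (cdf_nat \<nu> j) < pgf X (1 - t j)"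
      using K unfolding D_def cdf by (simp only: mult_less_0_iff) auto
    also have "\<dots> \<longleftrightarrow> t j < tail \<nu> j"
      using strict_mono_on_less[OF smo mem(2,1)] by (auto simp: tail_eq)
    finally show "t j < tail \<nu> j \<longleftrightarrow> D j < 0" by simp
  qed
  show "\<forall>\<^sub>F j in sequentially. tail \<nu> j < t j" if "\<eta> > - ((\<beta> + 1) * pi\<^sup>2 / 12)"
  proof -
    have "0 < \<eta> + (\<beta> + 1) * pi\<^sup>2 / 12" using that by simp
    from order_tendstoD(1)[OF D this] ev eventually_ge_at_top[of 1] show ?thesis
    proof eventually_elim
      case (elim j)
      then show ?case using compare(1)[of j] by blast
    qed
  qed
  show "\<forall>\<^sub>F j in sequentially. t j < tail \<nu> j" if "\<eta> < - ((\<beta> + 1) * pi\<^sup>2 / 12)"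
  proof -
    have "\<eta> + (\<beta> + 1) * pi\<^sup>2 / 12 < 0" using that by simp
    from order_tendstoD(2)[OF D this] ev eventually_ge_at_top[of 1] show ?thesis
    proof eventually_elim
      case (elim j)
      then show ?case using compare(2)[of j] by blast
    qed
  qed
qed

text \<open>The trap is applied with coefficients slightly above and below \<open>\<delta>\<close>.
  The half-width \<open>e' = e / c\<close> makes the two trial tails differ from the claimed
  expansion by exactly \<open>e / (j * ln j)\<close>.\<close>

lemma branching_tail_expansion:
  assumes \<nu>: "branching_law X \<nu>"
  defines "d \<equiv> - ((\<beta> + 1) * exp (- euler_mascheroni) * pi\<^sup>2 / 12)"
  shows "(\<lambda>j. tail \<nu> j - (exp (- euler_mascheroni) / real j + d / (real j * ln (real j))))
          \<in> o(\<lambda>j. 1 / (real j * ln (real j)))"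
proof (rule landau_o.smallI)
  fix e :: real assume e: "e > 0"
  define c :: real where "c = exp (- euler_mascheroni)"
  have c: "c > 0" by (simp add: c_def)
  define \<delta> where "\<delta> = - ((\<beta> + 1) * pi\<^sup>2 / 12)"
  have d: "d = c * \<delta>" by (simp add: d_def c_def \<delta>_def)
  define e' where "e' = e / c"
  have e': "e = c * e'" using c by (simp add: e'_def)
  have "\<delta> + e' > \<delta>" "\<delta> - e' < \<delta>" using e c by (auto simp: e'_def)
  note trap = branching_tail_trap(1)[OF \<nu> this(1)[unfolded \<delta>_def], folded c_def \<delta>_def]
    branching_tail_trap(2)[OF \<nu> this(2)[unfolded \<delta>_def], folded c_def \<delta>_def]
  show "\<forall>\<^sub>F j in sequentially. norm (tail \<nu> j - (exp (- euler_mascheroni) / real j + d / (real j * ln (real j))))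
      \<le> e * norm (1 / (real j * ln (real j)))"
    using trap eventually_gt_at_top[of 1] unfolding c_def[symmetric]
  proof eventually_elim
    case (elim j)
    then have ln: "ln (real j) > 0" "real j > 0" by auto
    have "c / real j * (1 + (\<delta> + e') / ln (real j)) = c / real j + d / (real j * ln (real j)) + e / (real j * ln (real j))"
      "c / real j * (1 + (\<delta> - e') / ln (real j)) = c / real j + d / (real j * ln (real j)) - e / (real j * ln (real j))"
      by (simp_all add: d e' divide_inverse algebra_simps)
    then show ?case using elim ln by (simp add: abs_le_iff)
  qed
qed

lemma branching_tail_first_order:
  assumes \<nu>: "branching_law X \<nu>"
  shows "(\<lambda>j. real j * tail \<nu> j) \<longlonglongrightarrow> exp (- euler_mascheroni)"
proof -
  define c :: real where "c = exp (- euler_mascheroni)"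
  define d where "d = - ((\<beta> + 1) * c * pi\<^sup>2 / 12)"
  have "(\<lambda>j. (tail \<nu> j - (c / real j + d / (real j * ln (real j)))) / (1 / (real j * ln (real j)))) \<longlonglongrightarrow> 0"
    using branching_tail_expansion[OF \<nu>] unfolding c_def d_def by (rule smalloD_tendsto)
  moreover have inv: "(\<lambda>j. 1 / ln (real j)) \<longlonglongrightarrow> 0" by real_asymp
  ultimately have "(\<lambda>j. (tail \<nu> j - (c / real j + d / (real j * ln (real j)))) / (1 / (real j * ln (real j))) * (1 / ln (real j))
      + (c + d * (1 / ln (real j)))) \<longlonglongrightarrow> 0 * 0 + (c + d * 0)"
    by (intro tendsto_intros)
  then have "(\<lambda>j. (tail \<nu> j - (c / real j + d / (real j * ln (real j)))) / (1 / (real j * ln (real j))) * (1 / ln (real j))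
      + (c + d * (1 / ln (real j)))) \<longlonglongrightarrow> c" by simp
  then show ?thesis unfolding c_def[symmetric]
  proof (rule Lim_transform_eventually)
    show "\<forall>\<^sub>F j in sequentially. (tail \<nu> j - (c / real j + d / (real j * ln (real j)))) / (1 / (real j * ln (real j))) * (1 / ln (real j))
      + (c + d * (1 / ln (real j))) = real j * tail \<nu> j"
      using eventually_gt_at_top[of 1]
    proof eventually_elim
      case (elim j)
      then have ln: "ln (real j) > 0" "real j > 0" by auto
      then show ?case by (simp add: field_simps)
    qed
  qed
qed

text \<open>Holds for every real \<open>d\<close>, since the second term is of smaller order than
  the first; the actual coefficient is fixed by \<open>branching_tail_expansion\<close>.\<close>

lemma branching_critical:
  assumes \<nu>: "branching_law X \<nu>"
  shows "lamperti_critical \<nu> d"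
  unfolding lamperti_critical_def
proof (rule asymp_equivI')
  define c :: real where "c = exp (- euler_mascheroni)"
  have c: "c > 0" by (simp add: c_def)
  have inv: "(\<lambda>j. 1 / ln (real j)) \<longlonglongrightarrow> 0" by real_asymp
  have "(\<lambda>j. real j * tail \<nu> j / (c + d * (1 / ln (real j)))) \<longlonglongrightarrow> c / (c + d * 0)"
    by (intro tendsto_intros inv branching_tail_first_order[OF \<nu>, folded c_def]) (use c in auto)
  then have "(\<lambda>j. real j * tail \<nu> j / (c + d * (1 / ln (real j)))) \<longlonglongrightarrow> 1" using c by simp
  then show "(\<lambda>j. tail \<nu> j / (exp (- euler_mascheroni) / real j + d / (real j * ln (real j)))) \<longlonglongrightarrow> 1"
  proof (rule Lim_transform_eventually)
    show "\<forall>\<^sub>F j in sequentially. real j * tail \<nu> j / (c + d * (1 / ln (real j))) =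
        tail \<nu> j / (exp (- euler_mascheroni) / real j + d / (real j * ln (real j)))"
      using eventually_gt_at_top[of 0]
    proof eventually_elim
      case (elim j)
      then have "c / real j + d / (real j * ln (real j)) = (c + d * (1 / ln (real j))) / real j"
        by (simp add: add_divide_distrib mult.commute)
      then show ?case by (simp add: c_def)
    qed
  qed
qed

end

theorem proposition5:
  fixes \<beta> C0 :: real and X :: "nat pmf"
  assumes "\<beta> > 0" and "C0 > 0"
    and "set_pmf X \<subseteq> {1..}"
    and "\<And>j. j \<ge> 1 \<Longrightarrow> pmf X j = C0 / (real j * L1 (real j) powr (\<beta> + 1))"
  shows "(\<forall>x>0. L1 x > 0) \<and> slowly_varying L1 \<and>
    (\<forall>q>0. (\<integral>\<^sup>+x. ennreal (real x powr q) \<partial>measure_pmf X) = \<infinity>) \<and>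
    tail X \<sim>[at_top] (\<lambda>j. C0 / \<beta> * L1 (real j) powr (- \<beta>)) \<and>
    (\<forall>a>0. filterlim (\<lambda>j. tail X j / real j powr (- a)) at_top at_top) \<and>
    bij_betw (pgf X) {0..1} {0..1} \<and>
    (\<exists>!\<nu>. branching_law X \<nu>) \<and>
    (\<forall>\<nu>. branching_law X \<nu> \<longrightarrow>
      (\<forall>j\<ge>1. cdf_nat \<nu> j = the_inv_into {0..1} (pgf X) (cdf_nat X j)) \<and>
      (\<lambda>j. real j * tail \<nu> j) \<longlonglongrightarrow> exp (- euler_mascheroni) \<and>
      (let d = - ((\<beta> + 1) * exp (- euler_mascheroni) * pi\<^sup>2 / 12) in
        (\<lambda>j. tail \<nu> j - (exp (- euler_mascheroni) / real j + d / (real j * ln (real j))))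
          \<in> o(\<lambda>j. 1 / (real j * ln (real j))) \<and>
        d < - (exp (- euler_mascheroni) * pi\<^sup>2 / 12) \<and>
        lamperti_critical \<nu> d) \<and>
      lamperti_positive_recurrent \<nu>)"
proof -
  interpret log_tail_law \<beta> C0 X
    using assms by unfold_locales
  \<comment> \<open>This positive quantity is the exact distance of \<open>d\<close> below the
    threshold of positive recurrence.\<close>
  have "0 < \<beta> * (exp (- euler_mascheroni) * pi\<^sup>2 / 12)"
    using assms(1) by (intro mult_pos_pos) auto
  moreover have "(\<beta> + 1) * exp (- euler_mascheroni) * pi\<^sup>2 / 12 =
      exp (- euler_mascheroni) * pi\<^sup>2 / 12 + \<beta> * (exp (- euler_mascheroni) * pi\<^sup>2 / 12)"
    by (simp only: distrib_right times_divide_eq_right mult.assoc mult_1_left add_divide_distrib add.commute)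
  ultimately have d: "- ((\<beta> + 1) * exp (- euler_mascheroni) * pi\<^sup>2 / 12) <
      - (exp (- euler_mascheroni) * pi\<^sup>2 / 12)"
    by linarith
  show ?thesis
    unfolding Let_def
  proof (intro conjI allI impI)
    show "L1 x > 0" if "x > 0" for x using that by (rule L1_pos)
    show "slowly_varying L1" by (rule slowly_varying_L1)
    show "(\<integral>\<^sup>+x. ennreal (real x powr q) \<partial>measure_pmf X) = \<infinity>" if "q > 0" for q
      using that by (rule moment_infinite)
    show "tail X \<sim>[at_top] (\<lambda>j. C0 / \<beta> * L1 (real j) powr (- \<beta>))" by (rule tail_asymp)
    show "filterlim (\<lambda>j. tail X j / real j powr (- a)) at_top at_top" if "a > 0" for a
      using that by (rule tail_heavy)
    show "bij_betw (pgf X) {0..1} {0..1}" by (rule bij_betw_pgf[OF set_X])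
    show "\<exists>!\<nu>. branching_law X \<nu>" by (rule ex1_branching_law[OF set_X])
  next
    fix \<nu> assume \<nu>: "branching_law X \<nu>"
    show "cdf_nat \<nu> j = the_inv_into {0..1} (pgf X) (cdf_nat X j)" for j
      by (rule branching_law_cdf[OF set_X \<nu>])
    show "(\<lambda>j. real j * tail \<nu> j) \<longlonglongrightarrow> exp (- euler_mascheroni)"
      by (rule branching_tail_first_order[OF \<nu>])
    show "(\<lambda>j. tail \<nu> j - (exp (- euler_mascheroni) / real j +
        - ((\<beta> + 1) * exp (- euler_mascheroni) * pi\<^sup>2 / 12) / (real j * ln (real j))))
        \<in> o(\<lambda>j. 1 / (real j * ln (real j)))"
      by (rule branching_tail_expansion[OF \<nu>])
    show "- ((\<beta> + 1) * exp (- euler_mascheroni) * pi\<^sup>2 / 12) < - (exp (- euler_mascheroni) * pi\<^sup>2 / 12)"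
      by (rule d)
    show "lamperti_critical \<nu> (- ((\<beta> + 1) * exp (- euler_mascheroni) * pi\<^sup>2 / 12))"
      by (rule branching_critical[OF \<nu>])
    show "lamperti_positive_recurrent \<nu>"
      by (rule lamperti_positive_recurrentI[OF set_pmf_eq_atLeast \<nu>])
  qed
qed

end
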